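(* Let $\Omega\subset\mathbb{C}$ be open and connected, and let $\mathcal{E}_1$ and $\mathcal{E}_2$ be Hermitian holomorphic vector bundles over $\Omega$. Set $\mathcal{H}_l=\bigvee_{w\in\Omega}\mathcal{E}_l(w)$ and let $P_l(w)$ denote the orthogonal projection from $\mathcal{H}_l$ onto $\mathcal{E}_l(w)$, $l=1,2$. Then for all $i,j\ge0$, $$\mathcal{K}_{i,j}(P_1\otimes P_2)=\mathcal{K}_{i,j}(P_1)\otimes P_2+P_1\otimes\mathcal{K}_{i,j}(P_2).$$
   Context: Here each $\mathcal{E}_l$ is a finite-rank Hermitian holomorphic bundle whose fibres $\mathcal{E}_l(w)$ are subspaces of a Hilbert space, spanned locally by holomorphic Hilbert-space-valued frames, with the inherited inner product; $\bigvee$ is closed linear span. For a unital $C^*$-algebra $\mathfrak U$, a holomorphic curve on the set $\mathcal{P}(\mathfrak U)$ of projections ($p=p^2=p^*$) is a real-analytic map $P:\Omega\to\mathcal{P}(\mathfrak U)$ with $\left(\frac{\partial}{\partial\overline w}P\right)P=0$; the maps $P_1,P_2$ and $P_1\otimes P_2$ (the pointwise tensor product, acting on $\mathcal{H}_1\otimes\mathcal{H}_2$) are such curves. The curvature and covariant derivatives of a holomorphic curve $P$ are defined by $$\mathcal{K}(P)=\mathcal{K}_{0,0}(P)=\frac{\partial P}{\partial\overline w}\frac{\partial P}{\partial w},\qquad \mathcal{K}_{i+1,j}(P)=P\,\frac{\partial}{\partial w}\big(\mathcal{K}_{i,j}(P)\big),\qquad \mathcal{K}_{i,j+1}(P)=\frac{\partial}{\partial\overline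 w}\big(\mathcal{K}_{i,j}(P)\big)\,P.$$ The order in which the $i$ steps in $w$ and the $j$ steps in $\overline w$ are performed to form $\mathcal K_{i,j}$ is arbitrary but is taken to be the same for $P_1$, $P_2$ and $P_1\otimes P_2$. *)

theory Defs
  imports "HOL-Analysis.Analysis"
begin

section \<open>Complex Hilbert spaces\<close>

text \<open>
  The inner product is linear in its first argument. The axiom \<open>cinner_self\<close> says that
  \<open>cinner x x\<close> is the real number \<open>(norm x)\<^sup>2\<close>, so it carries positivity and definiteness.
\<close>

class chilbert_space = banach +
  fixes scaleC :: "complex \<Rightarrow> 'a \<Rightarrow> 'a" (infixr "*\<^sub>C" 75)
    and cinner :: "'a \<Rightarrow> 'a \<Rightarrow> complex"
  assumes scaleC_add_right: "c *\<^sub>C (x + y) = c *\<^sub>C x + c *\<^sub>C y"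
    and scaleC_add_left: "(c + d) *\<^sub>C x = c *\<^sub>C x + d *\<^sub>C x"
    and scaleC_scaleC: "c *\<^sub>C (d *\<^sub>C x) = (c * d) *\<^sub>C x"
    and scaleC_of_real: "complex_of_real r *\<^sub>C x = r *\<^sub>R x"
    and cinner_commute: "cinner x y = cnj (cinner y x)"
    and cinner_add_left: "cinner (x + y) z = cinner x z + cinner y z"
    and cinner_scaleC_left: "cinner (c *\<^sub>C x) y = c * cinner x y"
    and cinner_self: "cinner x x = complex_of_real ((norm x)\<^sup>2)"

instantiation complex :: chilbert_space
begin

definition scaleC_complex :: "complex \<Rightarrow> complex \<Rightarrow> complex"
  where "scaleC_complex c x = c * x"

definition cinner_complex :: "complex \<Rightarrow> complex \<Rightarrow> complex"
  where "cinner_complex x y = x * cnj y"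

instance
  by standard
    (simp_all add: scaleC_complex_def cinner_complex_def algebra_simps scaleR_conv_of_real
      complex_norm_square del: of_real_power)

end

global_interpretation complex_vector:
  vector_space "scaleC :: complex \<Rightarrow> 'a \<Rightarrow> 'a::chilbert_space"
  by standard
    (use scaleC_of_real[of 1] in \<open>simp_all add: scaleC_add_right scaleC_add_left scaleC_scaleC\<close>)

abbreviation clinear :: "('a::chilbert_space \<Rightarrow> 'b::chilbert_space) \<Rightarrow> bool"
  where "clinear \<equiv> Vector_Spaces.linear scaleC scaleC"

lemma norm_scaleC: "norm (c *\<^sub>C (x::'a::chilbert_space)) = cmod c * norm x"
proof -
  have "complex_of_real ((norm (c *\<^sub>C x))\<^sup>2) = c * cnj c * cinner x x"
    unfolding cinner_self[symmetric]
    by (metis cinner_commute cinner_scaleC_left complex_cnj_mult mult.assoc)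
  also have "\<dots> = complex_of_real ((cmod c * norm x)\<^sup>2)"
    by (simp add: cinner_self complex_norm_square[symmetric] power_mult_distrib)
  finally have "(norm (c *\<^sub>C x))\<^sup>2 = (cmod c * norm x)\<^sup>2"
    by (simp only: of_real_eq_iff)
  then show ?thesis
    by (simp add: power2_eq_iff_nonneg)
qed

section \<open>Operators\<close>

text \<open>
  The operator norm on the bounded complex-linear operators of a Hilbert space \<open>'h\<close> is the
  norm of the type \<open>'h \<Rightarrow>\<^sub>L 'h\<close> of bounded real-linear ones, in which they form a closed
  subspace.  Complex linearity is required explicitly where it matters.
\<close>

lift_definition scaleC_op :: "complex \<Rightarrow> ('h::chilbert_space \<Rightarrow>\<^sub>L 'h) \<Rightarrow> ('h \<Rightarrow>\<^sub>L 'h)"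
  is "\<lambda>c T x. c *\<^sub>C T x"
proof -
  fix c :: complex and T :: "'h \<Rightarrow> 'h"
  assume "bounded_linear T"
  then interpret T: bounded_linear T .
  obtain K where K: "\<And>x. norm (T x) \<le> norm x * K"
    using T.bounded by blast
  show "bounded_linear (\<lambda>x. c *\<^sub>C T x)"
  proof (rule bounded_linear_intro[where K = "cmod c * K"])
    show "c *\<^sub>C T (x + y) = c *\<^sub>C T x + c *\<^sub>C T y" for x y
      by (simp add: T.add scaleC_add_right)
    show "c *\<^sub>C T (r *\<^sub>R x) = r *\<^sub>R (c *\<^sub>C T x)" for r x
      unfolding T.scaleR unfolding scaleC_of_real[symmetric] scaleC_scaleC by (simp only: mult.commute)
    show "norm (c *\<^sub>C T x) \<le> norm x * (cmod c * K)" for x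
      using mult_left_mono[OF K[of x], of "cmod c"] by (simp add: norm_scaleC mult_ac)
  qed
qed

definition orthogonal_projection_onto :: "('h::chilbert_space \<Rightarrow>\<^sub>L 'h) \<Rightarrow> 'h set \<Rightarrow> bool"
  where "orthogonal_projection_onto p M \<longleftrightarrow>
    clinear (blinfun_apply p) \<and>
    p o\<^sub>L p = p \<and>
    (\<forall>x y. cinner (p x) y = cinner x (p y)) \<and>
    range (blinfun_apply p) = M"

section \<open>Hermitian holomorphic vector bundles\<close>

definition holomorphic_map_on :: "(complex \<Rightarrow> 'a::chilbert_space) \<Rightarrow> complex set \<Rightarrow> bool"
  where "holomorphic_map_on f U \<longleftrightarrow>
    (\<forall>w\<in>U. \<exists>D. (f has_derivative (\<lambda>h. h *\<^sub>C D)) (at w within U))"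

text \<open>
  The rank is the same number \<open>n\<close> on all of \<open>\<Omega>\<close>. The Hermitian metric is the inner product of
  the ambient space \<open>'a\<close>.
\<close>

definition hermitian_holomorphic_bundle ::
    "complex set \<Rightarrow> (complex \<Rightarrow> 'a::chilbert_space set) \<Rightarrow> bool"
  where "hermitian_holomorphic_bundle \<Omega> E \<longleftrightarrow>
    (\<exists>n::nat. \<forall>w\<^sub>0\<in>\<Omega>. \<exists>U s. open U \<and> w\<^sub>0 \<in> U \<and> U \<subseteq> \<Omega> \<and>
      (\<forall>k<n. holomorphic_map_on (s k) U) \<and>
      (\<forall>w\<in>U. inj_on (\<lambda>k. s k w) {..<n} \<and>
        complex_vector.independent ((\<lambda>k. s k w) ` {..<n}) \<and>
        complex_vector.span ((\<lambda>k. s k w) ` {..<n}) = E w))"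

text \<open>
  The closed linear span of the fibres is a subspace of the ambient space \<open>'a\<close> and not itself a
  type. A Hilbert space \<open>'h\<close> together with a linear isometry \<open>\<iota>\<close> of \<open>'h\<close> onto that subspace stands
  for it; \<open>\<iota>\<close> is then the inclusion, and the fibre at \<open>w\<close>, as a subspace of \<open>'h\<close>, is \<open>\<iota> -` E w\<close>.
\<close>

definition closed_span_of_fibres ::
    "complex set \<Rightarrow> (complex \<Rightarrow> 'a::chilbert_space set) \<Rightarrow> ('h::chilbert_space \<Rightarrow> 'a) \<Rightarrow> bool"
  where "closed_span_of_fibres \<Omega> E \<iota> \<longleftrightarrow>
    clinear \<iota> \<and>
    (\<forall>x y. cinner (\<iota> x) (\<iota> y) = cinner x y) \<and>
    range \<iota> = closure (complex_vector.span (\<Union>w\<in>\<Omega>. E w))"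

section \<open>Tensor products\<close>

text \<open>
  \<open>'k\<close>, with \<open>t x y\<close> in the role of the simple tensor of \<open>x\<close> and \<open>y\<close>, is the Hilbert space tensor
  product of \<open>'h\<^sub>1\<close> and \<open>'h\<^sub>2\<close>: the completion of the algebraic tensor product in the inner product
  that is multiplicative on simple tensors. These conditions determine it up to unitary equivalence.
\<close>

definition hilbert_tensor_product ::
    "('h1::chilbert_space \<Rightarrow> 'h2::chilbert_space \<Rightarrow> 'k::chilbert_space) \<Rightarrow> bool"
  where "hilbert_tensor_product t \<longleftrightarrow>
    (\<forall>y. clinear (\<lambda>x. t x y)) \<and>
    (\<forall>x. clinear (t x)) \<and>
    (\<forall>x x' y y'. cinner (t x y) (t x' y') = cinner x x' * cinner y y') \<and>
    closure (complex_vector.span {t x y | x y. True}) = UNIV"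

text \<open>
  For bounded complex-linear \<open>A\<close> and \<open>B\<close> there is exactly one bounded complex-linear operator \<open>T\<close>
  as in the description below.
\<close>

definition tensor_op ::
    "('h1::chilbert_space \<Rightarrow> 'h2::chilbert_space \<Rightarrow> 'k::chilbert_space) \<Rightarrow>
      ('h1 \<Rightarrow>\<^sub>L 'h1) \<Rightarrow> ('h2 \<Rightarrow>\<^sub>L 'h2) \<Rightarrow> ('k \<Rightarrow>\<^sub>L 'k)"
  where "tensor_op t A B =
    (THE T. clinear (blinfun_apply T) \<and> (\<forall>x y. T (t x y) = t (A x) (B y)))"

section \<open>Curvature and its covariant derivatives\<close>

text \<open>Wirtinger derivatives, taken in the operator norm.\<close>

definition d_w :: "(complex \<Rightarrow> 'h::chilbert_space \<Rightarrow>\<^sub>L 'h) \<Rightarrow> complex \<Rightarrow> 'h \<Rightarrow>\<^sub>L 'h"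
  where "d_w F w = (1/2) *\<^sub>R
    (frechet_derivative F (at w) 1 - scaleC_op \<i> (frechet_derivative F (at w) \<i>))"

definition d_wbar :: "(complex \<Rightarrow> 'h::chilbert_space \<Rightarrow>\<^sub>L 'h) \<Rightarrow> complex \<Rightarrow> 'h \<Rightarrow>\<^sub>L 'h"
  where "d_wbar F w = (1/2) *\<^sub>R
    (frechet_derivative F (at w) 1 + scaleC_op \<i> (frechet_derivative F (at w) \<i>))"

datatype direction = Dir_w | Dir_wbar

text \<open>
  An order of performing \<open>i\<close> steps in \<open>w\<close> and \<open>j\<close> steps in the conjugate variable is a list of
  directions; the head of the list is the step performed last.
\<close>

definition orders :: "nat \<Rightarrow> nat \<Rightarrow> direction list set"
  where "orders i j = {\<sigma>. count_list \<sigma> Dir_w = i \<and> count_list \<sigma> Dir_wbar = j}"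

fun curvature_deriv ::
    "direction list \<Rightarrow> (complex \<Rightarrow> 'h::chilbert_space \<Rightarrow>\<^sub>L 'h) \<Rightarrow> complex \<Rightarrow> 'h \<Rightarrow>\<^sub>L 'h"
  where
    "curvature_deriv [] P = (\<lambda>w. d_wbar P w o\<^sub>L d_w P w)"
  | "curvature_deriv (Dir_w # \<sigma>) P = (\<lambda>w. P w o\<^sub>L d_w (curvature_deriv \<sigma> P) w)"
  | "curvature_deriv (Dir_wbar # \<sigma>) P = (\<lambda>w. d_wbar (curvature_deriv \<sigma> P) w o\<^sub>L P w)"

end

theory Submission
  imports Defs "HOL-Complex_Analysis.Cauchy_Integral_Formula"
begin

text \<open>
  On a holomorphic frame \<open>\<sigma>\<close> of the bundle, differentiating \<open>P \<sigma> = \<sigma>\<close> gives \<open>d_wbar P o\<^sub>L P = 0\<close>, and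
  the adjoint identity is \<open>P o\<^sub>L d_w P = 0\<close>. Consequently every covariant derivative \<open>K\<close> of the
  curvature satisfies \<open>P o\<^sub>L K = K = K o\<^sub>L P\<close>, and when a covariant derivative of
  \<open>K\<^sub>1 \<otimes> P\<^sub>2 + P\<^sub>1 \<otimes> K\<^sub>2\<close> is expanded by the product rule the mixed terms vanish.

  What needs work is that all these derivatives exist in the operator norm. A holomorphic
  Hilbert-space-valued map is infinitely differentiable by Cauchy's inequalities for its scalar
  products with vectors, and Gram-Schmidt orthogonalisation of a frame, carried out on projections
  as \<open>Q + r r\<^sup>* / \<parallel>r\<parallel>\<^sup>2\<close> with \<open>r = \<sigma> - Q \<sigma>\<close>, transfers this to \<open>P\<close>. The tensor product of operators
  is bounded and bilinear because every finite sum of simple tensors can be rewritten with an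
  orthonormal family in one of the two factors.
\<close>

section \<open>Inner products and complex-linear operators\<close>

text \<open>The operator type contains all bounded real-linear maps, whereas
  \<open>tensor_op\<close> is meaningful on complex-linear ones only and \<open>\<i>\<close> can be
  pulled out of a composition only past a complex-linear left factor. The calculus is therefore
  real: real-bilinear products satisfy the product rule for real partial derivatives, and the
  Wirtinger rule follows once derivatives of complex-linear operators are known to be
  complex-linear. Since \<open>frechet_derivative\<close> is a choice operator, its value is
  arbitrary where no derivative exists; this is why smoothness is carried along through every
  construction. Frames exist only locally, so the work is done on a neighbourhood of the given
  point.

  The block above contains a garbled sentence and is to be discarded. The complete reply
  follows.\<close>

lemma cinner_add_right: "cinner x (y + z) = cinner x y + cinner x z"
  by (metis cinner_add_left cinner_commute complex_cnj_add)

lemma cinner_scaleC_right: "cinner x (c *\<^sub>C y) = cnj c * cinner x y"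
  by (metis cinner_commute cinner_scaleC_left complex_cnj_mult)

lemma cinner_scaleR_left: "cinner (r *\<^sub>R x) y = r *\<^sub>R cinner x y"
  by (simp add: scaleC_of_real[of r x, symmetric] cinner_scaleC_left scaleR_conv_of_real)

lemma cinner_scaleR_right: "cinner x (r *\<^sub>R y) = r *\<^sub>R cinner x y"
  by (simp add: scaleC_of_real[of r y, symmetric] cinner_scaleC_right scaleR_conv_of_real)

lemma cinner_zero_left [simp]: "cinner 0 y = 0"
  using cinner_scaleR_left[of 0 0 y] by simp

lemma cinner_zero_right [simp]: "cinner x 0 = 0"
  using cinner_scaleR_right[of x 0 0] by simp

lemma cinner_minus_left: "cinner (- x) y = - cinner x y"
  using cinner_scaleR_left[of "-1" x y] by simp

lemma cinner_minus_right: "cinner x (- y) = - cinner x y"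
  using cinner_scaleR_right[of x "-1" y] by simp

lemma cinner_diff_left: "cinner (x - y) z = cinner x z - cinner y z"
  using cinner_add_left[of x "-y" z] by (simp add: cinner_minus_left)

lemma cinner_diff_right: "cinner x (y - z) = cinner x y - cinner x z"
  using cinner_add_right[of x y "-z"] by (simp add: cinner_minus_right)

lemma cinner_sum_left: "cinner (\<Sum>e\<in>S. f e) y = (\<Sum>e\<in>S. cinner (f e) y)"
  by (induction S rule: infinite_finite_induct) (simp_all add: cinner_add_left)

lemma cinner_sum_right: "cinner y (\<Sum>e\<in>S. f e) = (\<Sum>e\<in>S. cinner y (f e))"
  by (induction S rule: infinite_finite_induct) (simp_all add: cinner_add_right)

lemmas cinner_simps = cinner_add_left cinner_add_right cinner_diff_left cinner_diff_right
  cinner_scaleC_left cinner_scaleC_right cinner_minus_left cinner_minus_right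
  cinner_scaleR_left cinner_scaleR_right

lemma cinner_self_eq_0_iff [simp]: "cinner x x = 0 \<longleftrightarrow> x = 0"
  by (simp add: cinner_self)

lemma cinner_eqI: "(\<And>y. cinner x y = cinner z y) \<Longrightarrow> x = z"
  using cinner_self_eq_0_iff[of "x - z"] by (simp add: cinner_diff_left)

lemma cmod_cinner_self: "cmod (cinner x x) = (norm x)\<^sup>2"
  by (simp add: cinner_self norm_power)

text \<open>Pythagoras: \<open>c *\<^sub>C y\<close> is the component of \<open>x\<close> along
  \<open>y\<close>, so its norm is at most that of \<open>x\<close>.\<close>

lemma norm_cinner_le: "cmod (cinner x y) \<le> norm x * norm y"
proof (cases "y = 0")
  case False
  define c where "c = cinner x y / cinner y y"
  have yy: "cinner y y \<noteq> 0" using False by simp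
  have "cinner (x - c *\<^sub>C y) (c *\<^sub>C y) = 0"
    using yy by (simp add: cinner_simps c_def)
  then have "cinner x x = cinner (x - c *\<^sub>C y) (x - c *\<^sub>C y) + cinner (c *\<^sub>C y) (c *\<^sub>C y)"
    using cinner_commute[of "c *\<^sub>C y" "x - c *\<^sub>C y"] by (simp add: cinner_diff_left cinner_diff_right)
  then have "complex_of_real ((norm x)\<^sup>2)
      = complex_of_real ((norm (x - c *\<^sub>C y))\<^sup>2 + (norm (c *\<^sub>C y))\<^sup>2)"
    by (simp add: cinner_self)
  then have "(norm x)\<^sup>2 = (norm (x - c *\<^sub>C y))\<^sup>2 + (norm (c *\<^sub>C y))\<^sup>2"
    using of_real_eq_iff by blast
  then have "(norm (c *\<^sub>C y))\<^sup>2 \<le> (norm x)\<^sup>2" by simp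
  then have "cmod c * norm y \<le> norm x" by (simp add: norm_scaleC)
  moreover have "cmod c = cmod (cinner x y) / (norm y)\<^sup>2"
    by (simp add: c_def norm_divide cmod_cinner_self)
  ultimately show ?thesis using False by (simp add: power2_eq_square field_simps)
qed simp

lemma scaleR_scaleC: "r *\<^sub>R c *\<^sub>C x = c *\<^sub>C r *\<^sub>R x"
  by (simp add: scaleC_of_real[symmetric] scaleC_scaleC mult.commute)

lemma scaleC_scaleR_left: "(r *\<^sub>R c) *\<^sub>C x = r *\<^sub>R c *\<^sub>C x"
  by (simp only: scaleC_of_real[of r "c *\<^sub>C x", symmetric] scaleC_scaleC scaleR_conv_of_real)

lemma bounded_bilinear_scaleC: "bounded_bilinear (scaleC :: complex \<Rightarrow> 'a \<Rightarrow> 'a::chilbert_space)"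
  by (rule bounded_bilinear.intro)
    (auto simp: scaleC_add_left scaleC_add_right scaleR_scaleC scaleC_scaleR_left norm_scaleC
      intro!: exI[of _ 1])

lemma bounded_bilinear_cinner:
  "bounded_bilinear (cinner :: 'a::chilbert_space \<Rightarrow> 'a \<Rightarrow> complex)"
  by (rule bounded_bilinear.intro) (auto simp: cinner_simps intro!: exI[of _ 1] norm_cinner_le)

lemmas bounded_linear_scaleC = bounded_bilinear.bounded_linear_right[OF bounded_bilinear_scaleC]

section \<open>Complex-linear operators among the real-linear ones\<close>

lemma clinear_iff:
  "clinear f \<longleftrightarrow> (\<forall>x y. f (x + y) = f x + f y) \<and> (\<forall>c x. f (c *\<^sub>C x) = c *\<^sub>C f x)"
  unfolding Vector_Spaces.linear_def module_hom_def module_hom_axioms_def module_def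
    vector_space_def
  by (auto simp: scaleC_add_left scaleC_add_right scaleC_scaleC)

lemma clinear_blinfun_iff:
  "clinear (blinfun_apply A) \<longleftrightarrow> (\<forall>c x. A (c *\<^sub>C x) = c *\<^sub>C A x)"
  by (simp add: clinear_iff blinfun.add_right)

lemma scaleC_op_apply [simp]: "scaleC_op c T x = c *\<^sub>C T x"
  by transfer simp

lemma blinfun_scaleC: "clinear (blinfun_apply A) \<Longrightarrow> A (c *\<^sub>C x) = c *\<^sub>C A x"
  by (simp add: clinear_blinfun_iff)

lemma clinear_comp: "clinear (blinfun_apply A) \<Longrightarrow> clinear (blinfun_apply B) \<Longrightarrow>
    clinear (blinfun_apply (A o\<^sub>L B))"
  by (simp add: clinear_blinfun_iff)

lemma clinear_zero: "clinear (blinfun_apply 0)"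
  by (simp add: clinear_blinfun_iff)

lemma clinear_add: "clinear (blinfun_apply A) \<Longrightarrow> clinear (blinfun_apply B) \<Longrightarrow>
    clinear (blinfun_apply (A + B))"
  by (simp add: clinear_blinfun_iff blinfun.add_left scaleC_add_right)

lemma clinear_scaleR: "clinear (blinfun_apply A) \<Longrightarrow> clinear (blinfun_apply (r *\<^sub>R A))"
  by (simp add: clinear_blinfun_iff blinfun.scaleR_left scaleR_scaleC)

lemma clinear_scaleC_op: "clinear (blinfun_apply A) \<Longrightarrow> clinear (blinfun_apply (scaleC_op c A))"
  by (simp add: clinear_blinfun_iff scaleC_scaleC mult.commute)

lemma bounded_linear_scaleC_op: "bounded_linear (scaleC_op c :: ('h::chilbert_space \<Rightarrow>\<^sub>L 'h) \<Rightarrow> _)"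
proof (rule bounded_linear_intro[where K = "cmod c"])
  fix T :: "'h \<Rightarrow>\<^sub>L 'h"
  show "norm (scaleC_op c T) \<le> norm T * cmod c"
    by (rule norm_blinfun_bound)
      (auto simp: norm_scaleC mult.assoc mult.commute[of "norm T" "cmod c"]
        intro!: mult_left_mono norm_blinfun)
qed (auto intro!: blinfun_eqI simp: blinfun.bilinear_simps scaleC_add_right scaleR_scaleC)

lemmas scaleC_op_add = bounded_linear.linear[OF bounded_linear_scaleC_op, THEN linear_add]

lemma scaleC_op_comp: "scaleC_op c A o\<^sub>L B = scaleC_op c (A o\<^sub>L B)"
  by (rule blinfun_eqI) simp

lemma comp_scaleC_op: "clinear (blinfun_apply A) \<Longrightarrow> A o\<^sub>L scaleC_op c B = scaleC_op c (A o\<^sub>L B)"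
  by (rule blinfun_eqI) (simp add: blinfun_scaleC)

text \<open>
  A bounded real-linear retraction of all operators onto the complex-linear ones. Precomposing
  with it turns operations that make sense on complex-linear operators only into total ones.
\<close>

definition clinear_part :: "('h::chilbert_space \<Rightarrow>\<^sub>L 'h) \<Rightarrow> ('h \<Rightarrow>\<^sub>L 'h)"
  where "clinear_part A = (1/2) *\<^sub>R (A - scaleC_op \<i> (A o\<^sub>L scaleC_op \<i> id_blinfun))"

lemma clinear_part_apply: "clinear_part A x = (1/2) *\<^sub>R (A x - \<i> *\<^sub>C A (\<i> *\<^sub>C x))"
  by (simp add: clinear_part_def blinfun.bilinear_simps)

lemma clinear_part_id:
  assumes "clinear (blinfun_apply A)" shows "clinear_part A = A"
proof (rule blinfun_eqI)
  fix x
  have "A x - \<i> *\<^sub>C A (\<i> *\<^sub>C x) = 2 *\<^sub>R A x"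
    using assms by (simp add: blinfun_scaleC scaleC_scaleC scaleR_2)
  then show "clinear_part A x = A x" by (simp add: clinear_part_apply)
qed

text \<open>Multiplying the argument by \<open>\<i>\<close> exchanges the two terms of
  \<open>clinear_part A\<close> up to a factor \<open>\<i>\<close>; real linearity then extends this
  from \<open>\<i>\<close> to all complex scalars.\<close>

lemma clinear_clinear_part: "clinear (blinfun_apply (clinear_part A))"
proof -
  have i: "clinear_part A (\<i> *\<^sub>C x) = \<i> *\<^sub>C clinear_part A x" for x
    by (simp add: clinear_part_apply scaleC_scaleC scaleR_scaleC[symmetric] blinfun.minus_right
        complex_vector.scale_right_diff_distrib)
  have "clinear_part A (c *\<^sub>C x) = c *\<^sub>C clinear_part A x" for c x
  proof -
    have c: "c *\<^sub>C y = Re c *\<^sub>R y + \<i> *\<^sub>C (Im c *\<^sub>R y)" for y :: 'a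
      by (subst complex_eq[of c])
        (simp add: scaleC_add_left scaleC_scaleC[symmetric] scaleC_of_real)
    show ?thesis by (subst (1 2) c) (simp add: blinfun.bilinear_simps i)
  qed
  then show ?thesis by (simp add: clinear_blinfun_iff)
qed

lemma bounded_linear_clinear_part: "bounded_linear clinear_part"
proof -
  have "bounded_linear (\<lambda>A. scaleC_op \<i> (A o\<^sub>L scaleC_op \<i> id_blinfun :: 'a \<Rightarrow>\<^sub>L 'a))"
    by (intro bounded_linear_compose[OF bounded_linear_scaleC_op]
        bounded_bilinear.bounded_linear_left[OF bounded_bilinear_blinfun_compose])
  then show ?thesis
    unfolding clinear_part_def[abs_def]
    by (intro bounded_linear_compose[OF bounded_linear_scaleR_right] bounded_linear_sub
        bounded_linear_ident)
qed

section \<open>Rank-one operators\<close>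

definition rank_one :: "'h::chilbert_space \<Rightarrow> 'h \<Rightarrow> ('h \<Rightarrow>\<^sub>L 'h)"
  where "rank_one x y = Blinfun (\<lambda>z. cinner z y *\<^sub>C x)"

lemma rank_one_apply [simp]: "rank_one x y z = cinner z y *\<^sub>C x"
proof -
  have "bounded_linear (\<lambda>z. cinner z y *\<^sub>C x)"
    by (rule bounded_linear_compose[OF
          bounded_bilinear.bounded_linear_left[OF bounded_bilinear_scaleC]
          bounded_bilinear.bounded_linear_left[OF bounded_bilinear_cinner]])
  then show ?thesis by (simp add: rank_one_def bounded_linear_Blinfun_apply)
qed

text \<open>Bilinearity is over the reals, \<open>rank_one\<close> being conjugate-linear in its
  second argument. This suffices for smoothness in the real sense.\<close>

lemma bounded_bilinear_rank_one: "bounded_bilinear rank_one"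
proof (rule bounded_bilinear.intro)
  have "norm (rank_one a b) \<le> norm a * norm b * 1" for a b :: 'a
  proof (rule norm_blinfun_bound)
    show "norm (rank_one a b x) \<le> norm a * norm b * 1 * norm x" for x
      using mult_right_mono[OF norm_cinner_le[of x b] norm_ge_zero[of a]]
      by (simp add: norm_scaleC mult_ac)
  qed simp
  then show "\<exists>K. \<forall>a b :: 'a. norm (rank_one a b) \<le> norm a * norm b * K" by blast
qed (auto intro!: blinfun_eqI simp: blinfun.bilinear_simps cinner_simps scaleC_add_right
    scaleC_add_left scaleR_scaleC scaleC_scaleR_left)

lemma clinear_rank_one: "clinear (blinfun_apply (rank_one x y))"
  by (simp add: clinear_blinfun_iff cinner_scaleC_left scaleC_scaleC)

section \<open>Smooth maps of a complex variable\<close>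

text \<open>The witnesses are the partial derivatives in the real and imaginary directions. They
  take values in the same space as \<open>f\<close>, so the recursion stays within one type instead
  of passing to spaces of multilinear maps. Level \<open>n\<close> means \<open>n\<close> times
  differentiable, without continuity of the last derivatives; over all \<open>n\<close> together
  this is smoothness.\<close>

primrec ck_on :: "nat \<Rightarrow> complex set \<Rightarrow> (complex \<Rightarrow> 'v::real_normed_vector) \<Rightarrow> bool"
  where
    "ck_on 0 U f = True"
  | "ck_on (Suc n) U f = (\<exists>f\<^sub>1 f\<^sub>2.
      (\<forall>z\<in>U. (f has_derivative (\<lambda>h. Re h *\<^sub>R f\<^sub>1 z + Im h *\<^sub>R f\<^sub>2 z)) (at z)) \<and>
      ck_on n U f\<^sub>1 \<and> ck_on n U f\<^sub>2)"

definition smooth_map_on :: "complex set \<Rightarrow> (complex \<Rightarrow> 'v::real_normed_vector) \<Rightarrow> bool"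
  where "smooth_map_on U f \<longleftrightarrow> (\<forall>n. ck_on n U f)"

lemma ck_on_SucI:
  assumes "\<And>z. z \<in> U \<Longrightarrow> (f has_derivative (\<lambda>h. Re h *\<^sub>R f\<^sub>1 z + Im h *\<^sub>R f\<^sub>2 z)) (at z)"
    and "ck_on n U f\<^sub>1" and "ck_on n U f\<^sub>2"
  shows "ck_on (Suc n) U f"
  using assms by auto

lemma ck_on_SucE:
  assumes "ck_on (Suc n) U f"
  obtains f\<^sub>1 f\<^sub>2
  where "\<And>z. z \<in> U \<Longrightarrow> (f has_derivative (\<lambda>h. Re h *\<^sub>R f\<^sub>1 z + Im h *\<^sub>R f\<^sub>2 z)) (at z)"
    and "ck_on n U f\<^sub>1" and "ck_on n U f\<^sub>2"
  using assms by auto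

lemma ck_on_mono: "ck_on (Suc n) U f \<Longrightarrow> ck_on n U f"
proof (induction n arbitrary: f)
  case (Suc n)
  from Suc.prems show ?case
  proof (rule ck_on_SucE)
    fix f\<^sub>1 f\<^sub>2
    assume "\<And>z. z \<in> U \<Longrightarrow> (f has_derivative (\<lambda>h. Re h *\<^sub>R f\<^sub>1 z + Im h *\<^sub>R f\<^sub>2 z)) (at z)"
      and "ck_on (Suc n) U f\<^sub>1" and "ck_on (Suc n) U f\<^sub>2"
    then show "ck_on (Suc n) U f" using Suc.IH by (intro ck_on_SucI[of U f f\<^sub>1 f\<^sub>2])
  qed
qed simp

lemma ck_on_subset: "ck_on n U f \<Longrightarrow> V \<subseteq> U \<Longrightarrow> ck_on n V f"
proof (induction n arbitrary: f)
  case (Suc n)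
  then obtain f\<^sub>1 f\<^sub>2 where
    "\<And>z. z \<in> U \<Longrightarrow> (f has_derivative (\<lambda>h. Re h *\<^sub>R f\<^sub>1 z + Im h *\<^sub>R f\<^sub>2 z)) (at z)"
    "ck_on n U f\<^sub>1" "ck_on n U f\<^sub>2"
    by (auto elim!: ck_on_SucE simp del: ck_on.simps)
  then show ?case using Suc.IH \<open>V \<subseteq> U\<close> by (intro ck_on_SucI[of V f f\<^sub>1 f\<^sub>2]) blast+
qed simp

lemma ck_on_cong:
  assumes "ck_on n U f" and "open U" and eq: "\<And>z. z \<in> U \<Longrightarrow> f z = g z"
  shows "ck_on n U g"
proof (cases n)
  case (Suc m)
  then obtain f\<^sub>1 f\<^sub>2 where *:
    "\<And>z. z \<in> U \<Longrightarrow> (f has_derivative (\<lambda>h. Re h *\<^sub>R f\<^sub>1 z + Im h *\<^sub>R f\<^sub>2 z)) (at z)"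
    "ck_on m U f\<^sub>1" "ck_on m U f\<^sub>2"
    using assms(1) by (auto elim!: ck_on_SucE)
  have "(g has_derivative (\<lambda>h. Re h *\<^sub>R f\<^sub>1 z + Im h *\<^sub>R f\<^sub>2 z)) (at z)" if "z \<in> U" for z
    using has_derivative_transform_within_open[OF *(1)[OF that] \<open>open U\<close> that] eq by blast
  then show ?thesis unfolding Suc using *(2,3) by (rule ck_on_SucI)
qed simp

lemma ck_on_zero: "ck_on n U (\<lambda>z. 0)"
proof (induction n)
  case (Suc n)
  then show ?case by (intro ck_on_SucI[where f\<^sub>1 = "\<lambda>z. 0" and f\<^sub>2 = "\<lambda>z. 0"]) auto
qed simp

lemma ck_on_linear: "bounded_linear l \<Longrightarrow> ck_on n U f \<Longrightarrow> ck_on n U (\<lambda>z. l (f z))"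
proof (induction n arbitrary: f)
  case (Suc n)
  interpret l: bounded_linear l by fact
  obtain f\<^sub>1 f\<^sub>2 where *:
    "\<And>z. z \<in> U \<Longrightarrow> (f has_derivative (\<lambda>h. Re h *\<^sub>R f\<^sub>1 z + Im h *\<^sub>R f\<^sub>2 z)) (at z)"
    "ck_on n U f\<^sub>1" "ck_on n U f\<^sub>2"
    using Suc.prems by (auto elim!: ck_on_SucE)
  show ?case
    by (rule ck_on_SucI[OF _ Suc.IH[OF Suc.prems(1) *(2)] Suc.IH[OF Suc.prems(1) *(3)]])
      (use l.has_derivative[OF *(1)] in \<open>simp add: l.add l.scaleR\<close>)
qed simp

lemma ck_on_add: "ck_on n U f \<Longrightarrow> ck_on n U g \<Longrightarrow> ck_on n U (\<lambda>z. f z + g z)"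
proof (induction n arbitrary: f g)
  case (Suc n)
  obtain f\<^sub>1 f\<^sub>2 where f:
    "\<And>z. z \<in> U \<Longrightarrow> (f has_derivative (\<lambda>h. Re h *\<^sub>R f\<^sub>1 z + Im h *\<^sub>R f\<^sub>2 z)) (at z)"
    "ck_on n U f\<^sub>1" "ck_on n U f\<^sub>2"
    using Suc.prems(1) by (auto elim!: ck_on_SucE)
  obtain g\<^sub>1 g\<^sub>2 where g:
    "\<And>z. z \<in> U \<Longrightarrow> (g has_derivative (\<lambda>h. Re h *\<^sub>R g\<^sub>1 z + Im h *\<^sub>R g\<^sub>2 z)) (at z)"
    "ck_on n U g\<^sub>1" "ck_on n U g\<^sub>2"
    using Suc.prems(2) by (auto elim!: ck_on_SucE)
  show ?case
  proof (rule ck_on_SucI[OF _ Suc.IH[OF f(2) g(2)] Suc.IH[OF f(3) g(3)]])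
    fix z assume "z \<in> U"
    from has_derivative_add[OF f(1)[OF this] g(1)[OF this]]
    show "((\<lambda>z. f z + g z) has_derivative
        (\<lambda>h. Re h *\<^sub>R (f\<^sub>1 z + g\<^sub>1 z) + Im h *\<^sub>R (f\<^sub>2 z + g\<^sub>2 z))) (at z)"
      by (simp add: algebra_simps)
  qed
qed simp

text \<open>Each partial derivative is a sum of products in which one factor is not differentiated,
  so the induction also uses \<open>f\<close> and \<open>g\<close> themselves at the lower
  order.\<close>

lemma ck_on_bilinear:
  assumes "bounded_bilinear p"
  shows "ck_on n U f \<Longrightarrow> ck_on n U g \<Longrightarrow> ck_on n U (\<lambda>z. p (f z) (g z))"
proof (induction n arbitrary: f g)
  case (Suc n)
  interpret p: bounded_bilinear p by fact
  obtain f\<^sub>1 f\<^sub>2 where f: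
    "\<And>z. z \<in> U \<Longrightarrow> (f has_derivative (\<lambda>h. Re h *\<^sub>R f\<^sub>1 z + Im h *\<^sub>R f\<^sub>2 z)) (at z)"
    "ck_on n U f\<^sub>1" "ck_on n U f\<^sub>2"
    using Suc.prems(1) by (auto elim!: ck_on_SucE)
  obtain g\<^sub>1 g\<^sub>2 where g:
    "\<And>z. z \<in> U \<Longrightarrow> (g has_derivative (\<lambda>h. Re h *\<^sub>R g\<^sub>1 z + Im h *\<^sub>R g\<^sub>2 z)) (at z)"
    "ck_on n U g\<^sub>1" "ck_on n U g\<^sub>2"
    using Suc.prems(2) by (auto elim!: ck_on_SucE)
  have fn: "ck_on n U f" and gn: "ck_on n U g"
    using Suc.prems by (simp_all only: ck_on_mono)
  show ?case
  proof (rule ck_on_SucI[OF _ ck_on_add[OF Suc.IH[OF fn g(2)] Suc.IH[OF f(2) gn]]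
        ck_on_add[OF Suc.IH[OF fn g(3)] Suc.IH[OF f(3) gn]]])
    fix z assume "z \<in> U"
    from p.FDERIV[OF f(1)[OF this] g(1)[OF this]]
    show "((\<lambda>z. p (f z) (g z)) has_derivative
        (\<lambda>h. Re h *\<^sub>R (p (f z) (g\<^sub>1 z) + p (f\<^sub>1 z) (g z))
          + Im h *\<^sub>R (p (f z) (g\<^sub>2 z) + p (f\<^sub>2 z) (g z)))) (at z)"
      by (simp add: p.add_left p.add_right p.scaleR_left p.scaleR_right algebra_simps)
  qed
qed simp

text \<open>The partial derivatives contain \<open>inverse (f z)\<close> again, but only to the
  lower order, where the induction hypothesis applies.\<close>

lemma ck_on_inverse:
  fixes f :: "complex \<Rightarrow> complex"
  assumes "\<And>z. z \<in> U \<Longrightarrow> f z \<noteq> 0"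
  shows "ck_on n U f \<Longrightarrow> ck_on n U (\<lambda>z. inverse (f z))"
proof (induction n)
  case (Suc n)
  obtain f\<^sub>1 f\<^sub>2 where f:
    "\<And>z. z \<in> U \<Longrightarrow> (f has_derivative (\<lambda>h. Re h *\<^sub>R f\<^sub>1 z + Im h *\<^sub>R f\<^sub>2 z)) (at z)"
    "ck_on n U f\<^sub>1" "ck_on n U f\<^sub>2"
    using Suc.prems(1) by (auto elim!: ck_on_SucE)
  have i: "ck_on n U (\<lambda>z. inverse (f z))"
    using Suc ck_on_mono by blast
  note m = ck_on_bilinear[OF bounded_bilinear_mult]
  have *: "ck_on n U (\<lambda>z. - (inverse (f z) * g z * inverse (f z)))" if "ck_on n U g" for g
    by (rule ck_on_linear[OF bounded_linear_minus[OF bounded_linear_ident] m[OF m[OF i that] i]])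
  show ?case
  proof (rule ck_on_SucI[OF _ *[OF f(2)] *[OF f(3)]])
    fix z assume z: "z \<in> U"
    from Deriv.has_derivative_inverse[OF assms[OF z] f(1)[OF z]]
    show "((\<lambda>z. inverse (f z)) has_derivative
        (\<lambda>h. Re h *\<^sub>R - (inverse (f z) * f\<^sub>1 z * inverse (f z))
          + Im h *\<^sub>R - (inverse (f z) * f\<^sub>2 z * inverse (f z)))) (at z)"
      by (simp add: algebra_simps)
  qed
qed simp

lemma smooth_map_on_cong:
  "smooth_map_on U f \<Longrightarrow> open U \<Longrightarrow> (\<And>z. z \<in> U \<Longrightarrow> f z = g z) \<Longrightarrow> smooth_map_on U g"
  unfolding smooth_map_on_def using ck_on_cong by metis

lemma smooth_map_on_subset: "smooth_map_on U f \<Longrightarrow> V \<subseteq> U \<Longrightarrow> smooth_map_on V f"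
  unfolding smooth_map_on_def using ck_on_subset by metis

lemma smooth_map_on_zero: "smooth_map_on U (\<lambda>z. 0)"
  by (simp add: smooth_map_on_def ck_on_zero)

lemma smooth_map_on_linear:
  "bounded_linear l \<Longrightarrow> smooth_map_on U f \<Longrightarrow> smooth_map_on U (\<lambda>z. l (f z))"
  by (simp add: smooth_map_on_def ck_on_linear)

lemma smooth_map_on_add:
  "smooth_map_on U f \<Longrightarrow> smooth_map_on U g \<Longrightarrow> smooth_map_on U (\<lambda>z. f z + g z)"
  by (simp add: smooth_map_on_def ck_on_add)

lemma smooth_map_on_diff:
  "smooth_map_on U f \<Longrightarrow> smooth_map_on U g \<Longrightarrow> smooth_map_on U (\<lambda>z. f z - g z)"
  using smooth_map_on_add[of U f "\<lambda>z. - g z"]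
    smooth_map_on_linear[OF bounded_linear_minus[OF bounded_linear_ident], of U g] by simp

lemma smooth_map_on_bilinear:
  "bounded_bilinear p \<Longrightarrow> smooth_map_on U f \<Longrightarrow> smooth_map_on U g \<Longrightarrow>
    smooth_map_on U (\<lambda>z. p (f z) (g z))"
  by (simp add: smooth_map_on_def ck_on_bilinear)

lemma smooth_map_on_inverse:
  fixes f :: "complex \<Rightarrow> complex"
  shows "smooth_map_on U f \<Longrightarrow> (\<And>z. z \<in> U \<Longrightarrow> f z \<noteq> 0) \<Longrightarrow> smooth_map_on U (\<lambda>z. inverse (f z))"
  by (simp add: smooth_map_on_def ck_on_inverse)

lemma smooth_map_on_has_derivative:
  assumes "smooth_map_on U f" and "z \<in> U"
  obtains a b where "(f has_derivative (\<lambda>h. Re h *\<^sub>R a + Im h *\<^sub>R b)) (at z)"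
proof -
  have "ck_on (Suc 0) U f" using assms(1) unfolding smooth_map_on_def by blast
  then show ?thesis using assms(2) that by (auto elim!: ck_on_SucE)
qed

subsection \<open>Wirtinger derivatives\<close>

lemma wirtinger:
  assumes "(F has_derivative (\<lambda>h. Re h *\<^sub>R a + Im h *\<^sub>R b)) (at w)"
  shows "d_w F w = (1/2) *\<^sub>R (a - scaleC_op \<i> b)"
    and "d_wbar F w = (1/2) *\<^sub>R (a + scaleC_op \<i> b)"
  unfolding d_w_def d_wbar_def frechet_derivative_at[OF assms, symmetric] by simp_all

lemma wirtinger_cong:
  assumes "smooth_map_on U F" and "open U" and "\<And>z. z \<in> U \<Longrightarrow> F z = G z" and "w \<in> U"
  shows "d_w G w = d_w F w" and "d_wbar G w = d_wbar F w"
proof -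
  obtain a b where *: "(F has_derivative (\<lambda>h. Re h *\<^sub>R a + Im h *\<^sub>R b)) (at w)"
    using assms(1,4) by (rule smooth_map_on_has_derivative)
  have "(G has_derivative (\<lambda>h. Re h *\<^sub>R a + Im h *\<^sub>R b)) (at w)"
    using has_derivative_transform_within_open[OF * assms(2,4)] assms(3) by blast
  with * show "d_w G w = d_w F w" and "d_wbar G w = d_wbar F w"
    by (simp_all add: wirtinger)
qed

lemma smooth_map_on_wirtinger:
  assumes "smooth_map_on U F" and "open U"
  shows "smooth_map_on U (d_w F)" and "smooth_map_on U (d_wbar F)"
proof -
  have "ck_on n U (d_w F) \<and> ck_on n U (d_wbar F)" for n
  proof -
    obtain f\<^sub>1 f\<^sub>2 where f:
      "\<And>z. z \<in> U \<Longrightarrow> (F has_derivative (\<lambda>h. Re h *\<^sub>R f\<^sub>1 z + Im h *\<^sub>R f\<^sub>2 z)) (at z)"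
      "ck_on n U f\<^sub>1" "ck_on n U f\<^sub>2"
      using assms(1)[unfolded smooth_map_on_def, rule_format, of "Suc n"]
      by (auto elim!: ck_on_SucE)
    have "ck_on n U (\<lambda>z. (1/2) *\<^sub>R (f\<^sub>1 z + (c *\<^sub>R scaleC_op \<i> (f\<^sub>2 z))))" for c :: real
      by (intro ck_on_linear[OF bounded_linear_scaleR_right] ck_on_add f
          ck_on_linear[OF bounded_linear_scaleC_op])
    from this[of "-1"] this[of 1] show ?thesis
      using wirtinger[OF f(1)] by (auto intro: ck_on_cong[OF _ \<open>open U\<close>])
  qed
  then show "smooth_map_on U (d_w F)" and "smooth_map_on U (d_wbar F)"
    by (auto simp: smooth_map_on_def)
qed

lemma wirtinger_add:
  assumes "smooth_map_on U F" and "smooth_map_on U G" and "w \<in> U"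
  shows "d_w (\<lambda>z. F z + G z) w = d_w F w + d_w G w"
    and "d_wbar (\<lambda>z. F z + G z) w = d_wbar F w + d_wbar G w"
proof -
  obtain a b where F: "(F has_derivative (\<lambda>h. Re h *\<^sub>R a + Im h *\<^sub>R b)) (at w)"
    using assms(1,3) by (rule smooth_map_on_has_derivative)
  obtain c d where G: "(G has_derivative (\<lambda>h. Re h *\<^sub>R c + Im h *\<^sub>R d)) (at w)"
    using assms(2,3) by (rule smooth_map_on_has_derivative)
  have "((\<lambda>z. F z + G z) has_derivative
      (\<lambda>h. Re h *\<^sub>R (a + c) + Im h *\<^sub>R (b + d))) (at w)"
    using has_derivative_add[OF F G] by (simp add: algebra_simps)
  then show "d_w (\<lambda>z. F z + G z) w = d_w F w + d_w G w"
    and "d_wbar (\<lambda>z. F z + G z) w = d_wbar F w + d_wbar G w"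
    by (simp_all only: wirtinger wirtinger[OF F] wirtinger[OF G] scaleC_op_add
        scaleR_add_right[symmetric] add_diff_add add.assoc add.left_commute[of "scaleC_op \<i> b"])
qed

text \<open>The retraction \<open>clinear_part\<close> fixes all values of \<open>F\<close> near
  \<open>w\<close>, hence by uniqueness of the derivative it fixes \<open>a\<close> and
  \<open>b\<close> as well.\<close>

lemma clinear_derivative:
  fixes F :: "complex \<Rightarrow> 'h::chilbert_space \<Rightarrow>\<^sub>L 'h"
  assumes "(F has_derivative (\<lambda>h. Re h *\<^sub>R a + Im h *\<^sub>R b)) (at w)"
    and "open U" and "w \<in> U" and "\<And>z. z \<in> U \<Longrightarrow> clinear (blinfun_apply (F z))"
  shows "clinear (blinfun_apply a)" and "clinear (blinfun_apply b)"
proof -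
  have "((\<lambda>z. clinear_part (F z)) has_derivative
      (\<lambda>h. clinear_part (Re h *\<^sub>R a + Im h *\<^sub>R b))) (at w)"
    by (rule bounded_linear.has_derivative[OF bounded_linear_clinear_part assms(1)])
  from has_derivative_transform_within_open[OF this assms(2,3)] assms(4)
  have "(F has_derivative (\<lambda>h. clinear_part (Re h *\<^sub>R a + Im h *\<^sub>R b))) (at w)"
    by (simp add: clinear_part_id)
  from has_derivative_unique[OF assms(1) this]
  have *: "Re h *\<^sub>R a + Im h *\<^sub>R b = clinear_part (Re h *\<^sub>R a + Im h *\<^sub>R b)" for h
    by (rule fun_cong)
  show "clinear (blinfun_apply a)" and "clinear (blinfun_apply b)"
    using *[of 1] *[of \<i>] clinear_clinear_part[of a] clinear_clinear_part[of b] by simp_all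
qed

lemma clinear_wirtinger:
  assumes "smooth_map_on U F" and "open U" and "w \<in> U"
    and "\<And>z. z \<in> U \<Longrightarrow> clinear (blinfun_apply (F z))"
  shows "clinear (blinfun_apply (d_w F w))" and "clinear (blinfun_apply (d_wbar F w))"
proof -
  obtain a b where F: "(F has_derivative (\<lambda>h. Re h *\<^sub>R a + Im h *\<^sub>R b)) (at w)"
    using assms(1,3) by (rule smooth_map_on_has_derivative)
  note ab = clinear_derivative[OF this assms(2-4)]
  have "clinear (blinfun_apply ((1/2) *\<^sub>R (a + r *\<^sub>R scaleC_op \<i> b)))" for r
    by (intro clinear_scaleR clinear_add clinear_scaleC_op ab)
  from this[of "-1"] this[of 1]
  show "clinear (blinfun_apply (d_w F w))" and "clinear (blinfun_apply (d_wbar F w))"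
    by (simp_all add: wirtinger[OF F])
qed

text \<open>Real bilinearity yields the rule for the real partial derivatives; moving
  \<open>\<i>\<close> out of either argument combines them into the Wirtinger rule. The conditions
  \<open>left\<close> and \<open>right\<close> are restricted to complex-linear operators because
  composition satisfies \<open>right\<close> only there.\<close>

lemma wirtinger_bilinear:
  assumes p: "bounded_bilinear p"
    and "smooth_map_on U F" and "smooth_map_on U G" and "open U" and "w \<in> U"
    and "\<And>z. z \<in> U \<Longrightarrow> clinear (blinfun_apply (F z))"
    and "\<And>z. z \<in> U \<Longrightarrow> clinear (blinfun_apply (G z))"
    and left: "\<And>A B. clinear (blinfun_apply A) \<Longrightarrow> clinear (blinfun_apply B) \<Longrightarrow>
      p (scaleC_op \<i> A) B = scaleC_op \<i> (p A B)"
    and right: "\<And>A B. clinear (blinfun_apply A) \<Longrightarrow> clinear (blinfun_apply B) \<Longrightarrow>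
      p A (scaleC_op \<i> B) = scaleC_op \<i> (p A B)"
  shows "d_w (\<lambda>z. p (F z) (G z)) w = p (d_w F w) (G w) + p (F w) (d_w G w)"
    and "d_wbar (\<lambda>z. p (F z) (G z)) w = p (d_wbar F w) (G w) + p (F w) (d_wbar G w)"
proof -
  interpret p: bounded_bilinear p by fact
  obtain a b where F: "(F has_derivative (\<lambda>h. Re h *\<^sub>R a + Im h *\<^sub>R b)) (at w)"
    using assms(2,5) by (rule smooth_map_on_has_derivative)
  obtain c d where G: "(G has_derivative (\<lambda>h. Re h *\<^sub>R c + Im h *\<^sub>R d)) (at w)"
    using assms(3,5) by (rule smooth_map_on_has_derivative)
  have "((\<lambda>z. p (F z) (G z)) has_derivative
      (\<lambda>h. Re h *\<^sub>R (p (F w) c + p a (G w)) + Im h *\<^sub>R (p (F w) d + p b (G w)))) (at w)"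
    using p.FDERIV[OF F G]
    by (simp add: p.add_left p.add_right p.scaleR_left p.scaleR_right algebra_simps)
  note pFG = wirtinger[OF this]
  have ab: "clinear (blinfun_apply a)" "clinear (blinfun_apply b)"
    using clinear_derivative[OF F assms(4-6)] by blast+
  have cd: "clinear (blinfun_apply c)" "clinear (blinfun_apply d)"
    using clinear_derivative[OF G assms(4,5,7)] by blast+
  show "d_w (\<lambda>z. p (F z) (G z)) w = p (d_w F w) (G w) + p (F w) (d_w G w)"
    and "d_wbar (\<lambda>z. p (F z) (G z)) w = p (d_wbar F w) (G w) + p (F w) (d_wbar G w)"
    unfolding pFG wirtinger[OF F] wirtinger[OF G]
    by (simp_all add: p.add_left p.add_right p.diff_left p.diff_right p.scaleR_left p.scaleR_right
        left[OF ab(2) assms(7)[OF \<open>w \<in> U\<close>]] right[OF assms(6)[OF \<open>w \<in> U\<close>] cd(2)]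
        scaleC_op_add scaleR_add_right scaleR_diff_right)
qed

lemma wirtinger_comp:
  assumes "smooth_map_on U F" and "smooth_map_on U G" and "open U" and "w \<in> U"
    and "\<And>z. z \<in> U \<Longrightarrow> clinear (blinfun_apply (F z))"
    and "\<And>z. z \<in> U \<Longrightarrow> clinear (blinfun_apply (G z))"
  shows "d_w (\<lambda>z. F z o\<^sub>L G z) w = (d_w F w o\<^sub>L G w) + (F w o\<^sub>L d_w G w)"
    and "d_wbar (\<lambda>z. F z o\<^sub>L G z) w = (d_wbar F w o\<^sub>L G w) + (F w o\<^sub>L d_wbar G w)"
  using wirtinger_bilinear[OF bounded_bilinear_blinfun_compose assms]
  by (simp_all only: scaleC_op_comp comp_scaleC_op)

section \<open>Hilbert-space-valued holomorphic maps\<close>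

lemma holomorphic_cinner:
  assumes "\<And>z. z \<in> U \<Longrightarrow> (f has_derivative (\<lambda>h. h *\<^sub>C f' z)) (at z)" and "z \<in> U"
  shows "((\<lambda>z. cinner (f z) y) has_field_derivative cinner (f' z) y) (at z)"
  using bounded_linear.has_derivative[OF
      bounded_bilinear.bounded_linear_left[OF bounded_bilinear_cinner] assms(1)[OF assms(2)], of y]
  by (simp add: has_field_derivative_def cinner_scaleC_left mult.commute[of _ "cinner (f' z) y"])

text \<open>Test with \<open>y = x\<close>. This converts estimates of scalar products that are
  uniform in \<open>y\<close> into estimates in norm.\<close>

lemma norm_le_cinnerI:
  assumes "\<And>y. cmod (cinner x y) \<le> C * norm y" and "0 \<le> C" shows "norm x \<le> C"
proof (cases "x = 0")
  case False
  have "norm x * norm x \<le> C * norm x"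
    using assms(1)[of x] by (simp add: cmod_cinner_self power2_eq_square)
  with False show ?thesis by (simp add: mult_le_cancel_right)
qed (use assms(2) in simp)

text \<open>
  Cauchy's inequalities for the scalar functions \<open>\<lambda>z. cinner (f z) y\<close> hold uniformly for \<open>y\<close> in the
  unit ball, so the difference quotients of \<open>f'\<close> form a Cauchy sequence in norm.
\<close>

lemma holomorphic_derivative:
  assumes "open U" and f: "\<And>z. z \<in> U \<Longrightarrow> (f has_derivative (\<lambda>h. h *\<^sub>C f' z)) (at z)"
    and w: "w \<in> U"
  shows "\<exists>D. (f' has_derivative (\<lambda>h. h *\<^sub>C D)) (at w)"
proof -
  define g where "g y z = cinner (f z) y" for y z
  have g': "(g y has_field_derivative cinner (f' z) y) (at z)" if "z \<in> U" for y z
    unfolding g_def[abs_def] using f that by (rule holomorphic_cinner)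
  have hol: "g y holomorphic_on U" for y
    using g' \<open>open U\<close> by (auto simp: holomorphic_on_open)
  have dg: "deriv (g y) z = cinner (f' z) y" if "z \<in> U" for y z
    using g'[OF that] by (rule DERIV_imp_deriv)
  obtain r where r: "0 < r" "cball w r \<subseteq> U"
    using \<open>open U\<close> w open_contains_cball by blast
  have "continuous_on (cball w r) f"
  proof (rule continuous_at_imp_continuous_on, rule ballI)
    show "isCont f z" if "z \<in> cball w r" for z
      using f[THEN has_derivative_continuous] that r(2) by blast
  qed
  then have "compact (f ` cball w r)" by (intro compact_continuous_image compact_cball)
  then obtain M where M: "0 < M" "\<And>z. z \<in> cball w r \<Longrightarrow> norm (f z) \<le> M"
    using compact_imp_bounded[of "f ` cball w r"] unfolding bounded_pos by blast
  \<comment> \<open>The expected value of the scalar product of the second derivative of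
    \<open>f\<close> at \<open>w\<close> with \<open>y\<close>; the vector itself is still to be
    found.\<close>
  define q where "q y = deriv (deriv (g y)) w" for y
  \<comment> \<open>Cauchy's inequality of order 3 on discs of radius \<open>r/2\<close> about
    points of \<open>ball w (r/2)\<close>: these discs stay in \<open>cball w r\<close>, where
    \<open>M\<close> bounds \<open>f\<close>, and \<open>6\<close> is \<open>fact 3\<close>.\<close>
  define K where "K = 6 * M / (r/2)^3"
  have K: "0 < K" using M r by (simp add: K_def)
  have third: "cmod ((deriv ^^ 3) (g y) z) \<le> K * norm y" if z: "z \<in> ball w (r/2)" for y z
  proof -
    have sub: "cball z (r/2) \<subseteq> cball w r"
      using z r(1) by (intro cball_subset_cball_iff[THEN iffD2]) (auto simp: dist_commute)
    have holz: "g y holomorphic_on cball z (r/2)"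
      using hol by (rule holomorphic_on_subset) (use sub r(2) in blast)
    have "cmod ((deriv ^^ 3) (g y) z) \<le> fact 3 * (M * norm y) / (r/2)^3"
    proof (rule Cauchy_inequality)
      show "g y holomorphic_on ball z (r/2)"
        using holz ball_subset_cball by (rule holomorphic_on_subset)
      show "continuous_on (cball z (r/2)) (g y)"
        using holz by (rule holomorphic_on_imp_continuous_on)
      fix x assume "norm (z - x) = r/2"
      then have "x \<in> cball z (r/2)" by (simp add: dist_norm)
      with sub have "norm (f x) \<le> M" by (intro M(2)) blast
      then show "norm (g y x) \<le> M * norm y"
        unfolding g_def by (rule order_trans[OF norm_cinner_le mult_right_mono]) simp
    qed (use r(1) in simp)
    also have "\<dots> = K * norm y" by (simp add: K_def fact_numeral)
    finally show ?thesis .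
  qed
  \<comment> \<open>First-order Taylor expansion of the derivative of \<open>g y\<close> at
    \<open>w\<close>; the remainder is governed by the third derivative of
    \<open>g y\<close>.\<close>
  have taylor: "cmod (cinner (f' z - f' w) y - (z - w) * q y) \<le> K * norm y * cmod (z - w) ^ 2"
    if z: "z \<in> ball w (r/2)" for y z
  proof -
    have sub: "ball w (r/2) \<subseteq> U" using r by (auto simp: subset_iff)
    have "cmod ((deriv ^^ Suc 0) (g y) z
        - (\<Sum>i\<le>1. (deriv ^^ Suc i) (g y) w * (z - w) ^ i / fact i))
      \<le> (K * norm y) * cmod (z - w) ^ Suc 1 / fact 1"
    proof (rule complex_Taylor[of "ball w (r/2)"])
      show "((deriv ^^ Suc i) (g y) has_field_derivative (deriv ^^ Suc (Suc i)) (g y) x)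
          (at x within ball w (r/2))" if "x \<in> ball w (r/2)" for i x
        using has_field_derivative_higher_deriv[OF hol \<open>open U\<close>] that sub
        by (blast intro: has_field_derivative_at_within)
      show "cmod ((deriv ^^ Suc (Suc 1)) (g y) x) \<le> K * norm y" if "x \<in> ball w (r/2)" for x
        using third[OF that, of y] by (simp add: numeral_3_eq_3)
    qed (use z r(1) in auto)
    then show ?thesis
      using dg w z sub
      by (simp add: q_def cinner_diff_left power2_eq_square algebra_simps subset_iff)
  qed
  \<comment> \<open>One null sequence of increments is enough to produce the limit; the factor
    \<open>r / 4\<close> keeps \<open>w + h n\<close> in the half ball, where \<open>taylor\<close>
    holds.\<close>
  define h where "h n = complex_of_real (r / 4 * inverse (real (Suc n)))" for n
  define X where "X n = inverse (h n) *\<^sub>C (f' (w + h n) - f' w)" for n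
  have h0: "h n \<noteq> 0" for n using r(1) by (simp add: h_def del: of_nat_Suc)
  have nh: "cmod (h n) = r / 4 * inverse (real (Suc n))" for n
    unfolding h_def norm_of_real using r(1) by simp
  have hb: "w + h n \<in> ball w (r/2)" for n
  proof -
    have "inverse (real (Suc n)) \<le> 1" by (simp add: field_simps)
    then have "r / 4 * inverse (real (Suc n)) \<le> r / 4 * 1"
      using r(1) by (intro mult_left_mono) auto
    then have "cmod (h n) \<le> r / 4" using nh[of n] by linarith
    then show ?thesis using r(1) by (simp add: dist_norm)
  qed
  have hlim: "(\<lambda>n. cmod (h n)) \<longlonglongrightarrow> 0"
    unfolding nh using tendsto_mult_right_zero[OF LIMSEQ_inverse_real_of_nat] by simp
  have Xq: "cmod (cinner (X n) y - q y) \<le> K * cmod (h n) * norm y" for n y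
  proof -
    have "cinner (X n) y - q y = inverse (h n) * (cinner (f' (w + h n) - f' w) y - h n * q y)"
      using h0[of n] by (simp add: X_def cinner_scaleC_left right_diff_distrib)
    then have "cmod (cinner (X n) y - q y)
        = cmod (cinner (f' (w + h n) - f' w) y - h n * q y) / cmod (h n)"
      by (simp only: norm_mult norm_inverse divide_inverse mult.commute)
    also have "\<dots> \<le> (K * norm y * cmod (h n) ^ 2) / cmod (h n)"
      using taylor[OF hb[of n], of y] by (intro divide_right_mono) auto
    finally show ?thesis using h0[of n] by (simp add: power2_eq_square mult_ac)
  qed
  \<comment> \<open>Both scalar products are compared with the same \<open>q y\<close>, uniformly in
    \<open>y\<close>.\<close>
  have XX: "norm (X m - X n) \<le> K * cmod (h m) + K * cmod (h n)" for m n
  proof (rule norm_le_cinnerI)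
    show "cmod (cinner (X m - X n) y) \<le> (K * cmod (h m) + K * cmod (h n)) * norm y" for y
      using norm_triangle_ineq4[of "cinner (X m) y - q y" "cinner (X n) y - q y"]
        Xq[of m y] Xq[of n y]
      by (simp add: cinner_diff_left algebra_simps)
  qed (use K in simp)
  have "Cauchy X"
  proof (rule CauchyI)
    fix e :: real assume e: "0 < e"
    have "(\<lambda>n. K * cmod (h n)) \<longlonglongrightarrow> 0" using tendsto_mult_right_zero[OF hlim] .
    then have "\<forall>\<^sub>F n in sequentially. K * cmod (h n) < e/2"
      using e by (intro order_tendstoD) auto
    then obtain N where N: "\<And>n. n \<ge> N \<Longrightarrow> K * cmod (h n) < e/2"
      by (auto simp: eventually_sequentially)
    have "norm (X m - X n) < e" if "m \<ge> N" "n \<ge> N" for m n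
      using XX[of m n] N[OF that(1)] N[OF that(2)] by linarith
    then show "\<exists>N. \<forall>m\<ge>N. \<forall>n\<ge>N. norm (X m - X n) < e" by blast
  qed
  then obtain D where D: "X \<longlonglongrightarrow> D" using Cauchy_convergent convergentD by blast
  \<comment> \<open>The norm limit represents the functional \<open>q\<close>, which identifies it
    independently of the sequence \<open>h\<close>.\<close>
  have Dq: "cinner D y = q y" for y
  proof (rule LIMSEQ_unique)
    show "(\<lambda>n. cinner (X n) y) \<longlonglongrightarrow> cinner D y"
      using bounded_bilinear.tendsto[OF bounded_bilinear_cinner D tendsto_const] .
    have "(\<lambda>n. K * cmod (h n) * norm y) \<longlonglongrightarrow> 0"
      by (intro tendsto_mult_left_zero tendsto_mult_right_zero hlim)
    then have "(\<lambda>n. cinner (X n) y - q y) \<longlonglongrightarrow> 0"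
      by (rule Lim_null_comparison[OF always_eventually[OF allI[OF Xq]]])
    then show "(\<lambda>n. cinner (X n) y) \<longlonglongrightarrow> q y" by (rule LIM_zero_cancel)
  qed
  \<comment> \<open>With \<open>D\<close> in place of \<open>q\<close>, \<open>taylor\<close>
    becomes a quadratic remainder bound in norm for all \<open>z\<close> near \<open>w\<close>, not
    only along \<open>h\<close>.\<close>
  have rem: "norm (f' z - f' w - (z - w) *\<^sub>C D) \<le> K * cmod (z - w) * cmod (z - w)"
    if "z \<in> ball w (r/2)" for z
  proof (rule norm_le_cinnerI)
    show "cmod (cinner (f' z - f' w - (z - w) *\<^sub>C D) y)
        \<le> K * cmod (z - w) * cmod (z - w) * norm y" for y
      using taylor[OF that, of y]
      by (simp add: cinner_diff_left cinner_scaleC_left Dq power2_eq_square mult_ac)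
  qed (use K in simp)
  have "(f' has_derivative (\<lambda>h. h *\<^sub>C D)) (at w)"
    unfolding has_derivative_at_within
  proof (intro conjI)
    show "bounded_linear (\<lambda>h. h *\<^sub>C D)"
      by (rule bounded_bilinear.bounded_linear_left[OF bounded_bilinear_scaleC])
    have "\<forall>\<^sub>F z in at w. z \<in> ball w (r/2)"
      using r(1) by (intro eventually_at_in_open') auto
    then have "\<forall>\<^sub>F z in at w. norm ((f' z - f' w - (z - w) *\<^sub>C D) /\<^sub>R norm (z - w))
        \<le> K * cmod (z - w)"
    proof eventually_elim
      case (elim z)
      show ?case
      proof (cases "z = w")
        case False
        have "inverse (cmod (z - w)) * norm (f' z - f' w - (z - w) *\<^sub>C D)
            \<le> inverse (cmod (z - w)) * (K * cmod (z - w) * cmod (z - w))"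
          using rem[OF elim] by (rule mult_left_mono) simp
        also have "\<dots> = K * cmod (z - w)" using False by simp
        finally show ?thesis by (simp only: norm_scaleR abs_inverse abs_norm_cancel)
      qed simp
    qed
    moreover have "((\<lambda>z. K * cmod (z - w)) \<longlongrightarrow> 0) (at w)"
      by (intro tendsto_mult_right_zero tendsto_norm_zero LIM_zero tendsto_ident_at)
    ultimately show "((\<lambda>z. (f' z - f' w - (z - w) *\<^sub>C D) /\<^sub>R norm (z - w)) \<longlongrightarrow> 0) (at w)"
      by (rule Lim_null_comparison)
  qed
  then show ?thesis ..
qed

lemma holomorphic_map_on_has_derivative:
  assumes "holomorphic_map_on f U" and "open U" and "z \<in> U"
  shows "\<exists>D. (f has_derivative (\<lambda>h. h *\<^sub>C D)) (at z)"
  using bspec[OF assms(1)[unfolded holomorphic_map_on_def] assms(3)]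
  unfolding at_within_open[OF assms(3,2)] .

lemma holomorphic_map_on_derivative:
  assumes "holomorphic_map_on f U" and "open U"
  obtains f' where "\<And>z. z \<in> U \<Longrightarrow> (f has_derivative (\<lambda>h. h *\<^sub>C f' z)) (at z)"
    and "holomorphic_map_on f' U"
proof -
  have "\<exists>D. (f has_derivative (\<lambda>h. h *\<^sub>C D)) (at z)" if "z \<in> U" for z
    using assms that by (rule holomorphic_map_on_has_derivative)
  then obtain f' where f': "\<And>z. z \<in> U \<Longrightarrow> (f has_derivative (\<lambda>h. h *\<^sub>C f' z)) (at z)"
    by metis
  have "\<exists>D. (f' has_derivative (\<lambda>h. h *\<^sub>C D)) (at z within U)" if "z \<in> U" for z
    unfolding at_within_open[OF that assms(2)] using assms(2) f' that by (rule holomorphic_derivative)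
  then have "holomorphic_map_on f' U"
    unfolding holomorphic_map_on_def by blast
  with f' show ?thesis by (rule that)
qed

text \<open>The real partial derivatives of \<open>f\<close> are \<open>f'\<close> and
  \<open>\<i> *\<^sub>C f'\<close>, and \<open>f'\<close> is again holomorphic.\<close>

lemma holomorphic_imp_smooth:
  assumes "holomorphic_map_on f U" and "open U" shows "smooth_map_on U f"
proof -
  have "ck_on n U f" if "holomorphic_map_on f U" for n and f :: "complex \<Rightarrow> 'a"
    using that
  proof (induction n arbitrary: f)
    case (Suc n)
    obtain f' where f': "\<And>z. z \<in> U \<Longrightarrow> (f has_derivative (\<lambda>h. h *\<^sub>C f' z)) (at z)"
      "holomorphic_map_on f' U"
      using holomorphic_map_on_derivative[OF Suc.prems \<open>open U\<close>] by metis
    have c: "h *\<^sub>C y = Re h *\<^sub>R y + Im h *\<^sub>R \<i> *\<^sub>C y" for h and y :: 'a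
      by (subst complex_eq[of h])
        (simp add: scaleC_add_left scaleC_of_real scaleR_scaleC scaleC_scaleC[symmetric])
    show ?case
      by (rule ck_on_SucI[OF _ Suc.IH[OF f'(2)]
            ck_on_linear[OF bounded_linear_scaleC[of \<i>] Suc.IH[OF f'(2)]]])
        (unfold c[symmetric], rule f'(1))
  qed simp
  with assms(1) show ?thesis by (simp add: smooth_map_on_def)
qed

section \<open>Tensor products of operators\<close>

text \<open>Continuous extension of a densely defined bounded operator. Prescribing a graph instead
  of a map makes well-definedness a consequence of the bound: a pair with first component zero has
  second component zero.\<close>

lemma blinfun_of_bounded_graph:
  fixes \<Gamma> :: "('a::real_normed_vector \<times> 'b::banach) set"
  assumes "subspace \<Gamma>" and bound: "\<And>u v. (u, v) \<in> \<Gamma> \<Longrightarrow> norm v \<le> K * norm u" and "0 \<le> K"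
    and dense: "closure (fst ` \<Gamma>) = UNIV"
  obtains T :: "'a \<Rightarrow>\<^sub>L 'b" where "\<And>u v. (u, v) \<in> \<Gamma> \<Longrightarrow> T u = v" and "norm T \<le> K"
proof -
  \<comment> \<open>The closure of \<open>\<Gamma>\<close>, described by sequences.\<close>
  define G where "G u v \<longleftrightarrow> (\<exists>X Y. (\<forall>n. (X n, Y n) \<in> \<Gamma>) \<and> X \<longlonglongrightarrow> u \<and> Y \<longlonglongrightarrow> v)" for u v
  have G_incl: "G u v" if "(u, v) \<in> \<Gamma>" for u v
    unfolding G_def by (rule exI[of _ "\<lambda>_. u"], rule exI[of _ "\<lambda>_. v"]) (use that in auto)
  have G_add: "G (u + u') (v + v')" if G: "G u v" "G u' v'" for u u' v v'
  proof -
    obtain X Y where XY: "\<And>n. (X n, Y n) \<in> \<Gamma>" "X \<longlonglongrightarrow> u" "Y \<longlonglongrightarrow> v"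
      using G(1) by (auto simp: G_def)
    obtain X' Y' where XY': "\<And>n. (X' n, Y' n) \<in> \<Gamma>" "X' \<longlonglongrightarrow> u'" "Y' \<longlonglongrightarrow> v'"
      using G(2) by (auto simp: G_def)
    have "(X n + X' n, Y n + Y' n) \<in> \<Gamma>" for n
      using subspace_add[OF \<open>subspace \<Gamma>\<close> XY(1)[of n] XY'(1)[of n]] by simp
    moreover note tendsto_add[OF XY(2) XY'(2)] tendsto_add[OF XY(3) XY'(3)]
    ultimately show ?thesis unfolding G_def
      by (intro exI[of _ "\<lambda>n. X n + X' n"] exI[of _ "\<lambda>n. Y n + Y' n"]) simp
  qed
  have G_scale: "G (r *\<^sub>R u) (r *\<^sub>R v)" if G: "G u v" for r u v
  proof -
    obtain X Y where XY: "\<And>n. (X n, Y n) \<in> \<Gamma>" "X \<longlonglongrightarrow> u" "Y \<longlonglongrightarrow> v"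
      using G by (auto simp: G_def)
    have "(r *\<^sub>R X n, r *\<^sub>R Y n) \<in> \<Gamma>" for n
      using subspace_scale[OF \<open>subspace \<Gamma>\<close> XY(1)[of n], of r] by simp
    moreover note tendsto_scaleR[OF tendsto_const XY(2)] tendsto_scaleR[OF tendsto_const XY(3)]
    ultimately show ?thesis unfolding G_def
      by (intro exI[of _ "\<lambda>n. r *\<^sub>R X n"] exI[of _ "\<lambda>n. r *\<^sub>R Y n"]) simp
  qed
  have G_bound: "norm v \<le> K * norm u" if G: "G u v" for u v
  proof -
    obtain X Y where XY: "\<And>n. (X n, Y n) \<in> \<Gamma>" "X \<longlonglongrightarrow> u" "Y \<longlonglongrightarrow> v"
      using G by (auto simp: G_def)
    show ?thesis
      using tendsto_norm[OF XY(3)] tendsto_mult[OF tendsto_const tendsto_norm[OF XY(2)]]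
      by (rule LIMSEQ_le) (use bound XY(1) in blast)
  qed
  have G_ex: "\<exists>v. G u v" for u
  proof -
    have "u \<in> closure (fst ` \<Gamma>)" using dense by simp
    then obtain X where X: "\<And>n. X n \<in> fst ` \<Gamma>" "X \<longlonglongrightarrow> u"
      unfolding closure_sequential by blast
    have "\<exists>y. (X n, y) \<in> \<Gamma>" for n using X(1)[of n] by force
    then obtain Y where Y: "\<And>n. (X n, Y n) \<in> \<Gamma>" by metis
    have YX: "norm (Y m - Y n) \<le> K * norm (X m - X n)" for m n
      using bound subspace_diff[OF \<open>subspace \<Gamma>\<close> Y[of m] Y[of n]] by simp
    have "Cauchy Y"
    proof (rule CauchyI)
      fix e :: real assume e: "0 < e"
      have "Cauchy X" using X(2) convergentI convergent_Cauchy by blast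
      then obtain N where N: "\<And>m n. m \<ge> N \<Longrightarrow> n \<ge> N \<Longrightarrow> norm (X m - X n) < e / (K + 1)"
        \<comment> \<open>Dividing by \<open>K + 1\<close> rather than \<open>K\<close> covers the
          case \<open>K = 0\<close>.\<close>
        using CauchyD[of X "e / (K + 1)"] e \<open>0 \<le> K\<close> by auto
      have "norm (Y m - Y n) < e" if "m \<ge> N" "n \<ge> N" for m n
      proof -
        have "norm (Y m - Y n) \<le> (K + 1) * norm (X m - X n)"
          using YX[of m n] by (simp add: distrib_right add_increasing2)
        also have "\<dots> < (K + 1) * (e / (K + 1))"
          using N[OF that] \<open>0 \<le> K\<close> by (intro mult_strict_left_mono) auto
        finally show ?thesis using \<open>0 \<le> K\<close> by simp
      qed
      then show "\<exists>N. \<forall>m\<ge>N. \<forall>n\<ge>N. norm (Y m - Y n) < e" by blast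
    qed
    then obtain v where "Y \<longlonglongrightarrow> v" using Cauchy_convergent convergentD by blast
    with X Y show ?thesis unfolding G_def by blast
  qed
  then obtain S where S: "\<And>u. G u (S u)" by metis
  \<comment> \<open>The difference of the two pairs lies in the closed graph over zero, and
    \<open>G_bound\<close> makes it vanish.\<close>
  have S_eq: "S u = v" if "G u v" for u v
    using G_bound[OF G_add[OF S[of u] G_scale[OF that, of "-1"]]] by simp
  have S_bl: "bounded_linear S"
    by (rule bounded_linear_intro[where K = K])
      (use S_eq G_add[OF S S] G_scale[OF S] G_bound[OF S] in \<open>simp_all add: mult.commute\<close>)
  have "norm (Blinfun S) \<le> K"
    using G_bound[OF S] by (intro norm_blinfun_bound) (simp_all add: \<open>0 \<le> K\<close> bounded_linear_Blinfun_apply[OF S_bl])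
  moreover have "Blinfun S u = v" if "(u, v) \<in> \<Gamma>" for u v
    using S_eq[OF G_incl[OF that]] by (simp add: bounded_linear_Blinfun_apply[OF S_bl])
  ultimately show ?thesis using that by blast
qed

section \<open>Algebraic tensors in orthonormal form\<close>

definition orthonormal :: "'h::chilbert_space set \<Rightarrow> bool"
  where "orthonormal S \<longleftrightarrow> (\<forall>e\<in>S. \<forall>d\<in>S. cinner e d = (if e = d then 1 else 0))"

locale hilbert_tensor =
  fixes t :: "'h1::chilbert_space \<Rightarrow> 'h2::chilbert_space \<Rightarrow> 'k::chilbert_space"
  assumes tensor: "hilbert_tensor_product t"
begin

lemma t_add_left: "t (x + x') y = t x y + t x' y"
  and t_add_right: "t x (y + y') = t x y + t x y'"
  and t_scaleC_left: "t (c *\<^sub>C x) y = c *\<^sub>C t x y"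
  and t_scaleC_right: "t x (c *\<^sub>C y) = c *\<^sub>C t x y"
  and cinner_t: "cinner (t x y) (t x' y') = cinner x x' * cinner y y'"
  and closure_span_t: "closure (complex_vector.span {t x y | x y. True}) = UNIV"
  using tensor unfolding hilbert_tensor_product_def clinear_iff by auto

lemma t_scaleR_left: "t (r *\<^sub>R x) y = r *\<^sub>R t x y"
  using t_scaleC_left[of "complex_of_real r"] by (simp add: scaleC_of_real)

lemma t_zero_left [simp]: "t 0 y = 0"
  using t_scaleR_left[of 0 0 y] by simp

lemma t_sum_right: "t x (\<Sum>e\<in>S. f e) = (\<Sum>e\<in>S. t x (f e))"
proof (induction S rule: infinite_finite_induct)
  have "t x 0 = 0" using t_scaleC_right[of x 0 0] by simp
  then show "t x (sum f {}) = (\<Sum>e\<in>{}. t x (f e))"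
    and "infinite A \<Longrightarrow> t x (sum f A) = (\<Sum>e\<in>A. t x (f e))" for A by simp_all
qed (simp add: t_add_right)

text \<open>A complex scalar can be absorbed into the first factor of a simple tensor. The density
  condition thereby concerns a real span, so it applies to operators that are only
  real-linear.\<close>

lemma complex_span_simple_tensors:
  "complex_vector.span {t x y | x y. True} = span {t x y | x y. True}"
proof
  show "complex_vector.span {t x y | x y. True} \<subseteq> span {t x y | x y. True}"
  proof
    fix u assume "u \<in> complex_vector.span {t x y | x y. True}"
    then show "u \<in> span {t x y | x y. True}"
    proof (induction rule: complex_vector.span_induct_alt)
      case (step c x y)
      then have "c *\<^sub>C x \<in> {t x y | x y. True}" by (auto simp: t_scaleC_left[symmetric]) blast
      then show ?case by (rule span_add[OF span_base step(2)])
    qed (rule span_zero)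
  qed
  show "span {t x y | x y. True} \<subseteq> complex_vector.span {t x y | x y. True}"
  proof
    fix u assume "u \<in> span {t x y | x y. True}"
    then show "u \<in> complex_vector.span {t x y | x y. True}"
    proof (induction rule: span_induct_alt)
      case (step r x y)
      then show ?case unfolding scaleC_of_real[symmetric]
        by (intro complex_vector.span_add complex_vector.span_scale) (rule complex_vector.span_base)
    qed (rule complex_vector.span_zero)
  qed
qed

lemma blinfun_eqI_simple_tensors:
  fixes S T :: "'k \<Rightarrow>\<^sub>L 'c::real_normed_vector"
  assumes "\<And>x y. S (t x y) = T (t x y)" shows "S = T"
proof (rule blinfun_eqI)
  have "span {t x y | x y. True} \<subseteq> {u. S u = T u}"
    by (rule span_minimal)
      (use assms in \<open>auto simp: subspace_def blinfun.add_right blinfun.scaleR_right\<close>)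
  moreover have "closed {u. S u = T u}"
    by (intro closed_Collect_eq continuous_intros)
  ultimately have "closure (span {t x y | x y. True}) \<subseteq> {u. S u = T u}"
    by (rule closure_minimal)
  then show "S u = T u" for u
    using closure_span_t unfolding complex_span_simple_tensors by auto
qed

text \<open>Pythagoras: by \<open>cinner_t\<close>, orthogonality of the second factors makes the
  summands pairwise orthogonal, whatever the first factors are.\<close>

lemma norm_orthonormal_sum:
  assumes "finite S" and "orthonormal S"
  shows "(norm (\<Sum>e\<in>S. t (f e) e))\<^sup>2 = (\<Sum>e\<in>S. (norm (f e))\<^sup>2)"
proof -
  have "cinner (\<Sum>e\<in>S. t (f e) e) (\<Sum>e\<in>S. t (f e) e)
      = (\<Sum>d\<in>S. \<Sum>e\<in>S. cinner (f d) (f e) * cinner d e)"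
    unfolding cinner_sum_left by (simp only: cinner_sum_right cinner_t)
  also have "\<dots> = (\<Sum>d\<in>S. \<Sum>e\<in>S. if d = e then cinner (f d) (f e) else 0)"
    using assms(2) by (intro sum.cong) (auto simp: orthonormal_def)
  also have "\<dots> = (\<Sum>d\<in>S. cinner (f d) (f d))"
    using assms(1) by simp
  finally have "complex_of_real ((norm (\<Sum>e\<in>S. t (f e) e))\<^sup>2)
      = complex_of_real (\<Sum>e\<in>S. (norm (f e))\<^sup>2)"
    by (simp add: cinner_self)
  then show ?thesis using of_real_eq_iff by blast
qed

text \<open>One family \<open>S\<close> with one choice of coefficients \<open>f\<close> represents
  both a tensor and its image under \<open>A \<otimes> 1\<close>, which makes their norms comparable
  term by term. To add a further simple tensor, its second factor is split along \<open>S\<close>,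
  and the normalised remainder joins \<open>S\<close> unless it is zero.\<close>

lemma orthonormal_representation:
  fixes A :: "'h1 \<Rightarrow>\<^sub>L 'h1"
  assumes A: "clinear (blinfun_apply A)"
    and "p \<in> span {(t x y, t (A x) y) | x y. True}"
  shows "\<exists>S f. finite S \<and> orthonormal S \<and>
    p = (\<Sum>e\<in>S. t (f e) e, \<Sum>e\<in>S. t (A (f e)) e)"
  using assms(2)
proof (induction rule: span_induct_alt)
  case base
  show ?case by (rule exI[of _ "{}"]) (simp add: orthonormal_def zero_prod_def)
next
  case (step r p q)
  obtain x' y where p: "p = (t x' y, t (A x') y)" using step(1) by blast
  define x where "x = r *\<^sub>R x'"
  have rp: "r *\<^sub>R p = (t x y, t (A x) y)"
    by (simp add: p x_def t_scaleR_left blinfun.scaleR_right)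
  obtain S f where S: "finite S" "orthonormal S"
    and q: "q = (\<Sum>e\<in>S. t (f e) e, \<Sum>e\<in>S. t (A (f e)) e)"
    using step(2) by blast
  define z where "z = y - (\<Sum>e\<in>S. cinner y e *\<^sub>C e)"
  \<comment> \<open>The components of \<open>y\<close> along \<open>S\<close> are absorbed into the
    existing coefficients; only \<open>t x z\<close> is left over.\<close>
  define g where "g e = f e + cinner y e *\<^sub>C x" for e
  have zS: "cinner z d = 0" if d: "d \<in> S" for d
  proof -
    have "(\<Sum>e\<in>S. cinner y e * cinner e d) = (\<Sum>e\<in>S. if e = d then cinner y e else 0)"
      using S(2) d by (intro sum.cong) (auto simp: orthonormal_def)
    also have "\<dots> = cinner y d" using S(1) d by simp
    finally show ?thesis by (simp add: z_def cinner_diff_left cinner_sum_left cinner_scaleC_left)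
  qed
  have ty: "t v y = (\<Sum>e\<in>S. t (cinner y e *\<^sub>C v) e) + t v z" for v
  proof -
    have "y = (\<Sum>e\<in>S. cinner y e *\<^sub>C e) + z" by (simp add: z_def)
    then have "t v y = t v ((\<Sum>e\<in>S. cinner y e *\<^sub>C e) + z)" by simp
    then show ?thesis
      by (simp add: t_add_right t_sum_right t_scaleC_right t_scaleC_left)
  qed
  have sum: "r *\<^sub>R p + q
      = ((\<Sum>e\<in>S. t (g e) e) + t x z, (\<Sum>e\<in>S. t (A (g e)) e) + t (A x) z)"
    unfolding rp q
    by (simp add: ty[of x] ty[of "A x"] g_def t_add_left sum.distrib blinfun.add_right
        blinfun_scaleC[OF A] add_ac)
  show ?case
  proof (cases "z = 0")
    case True
    have "t v z = 0" for v using t_scaleC_right[of v 0 z] True by simp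
    with S sum show ?thesis by (intro exI[of _ S] exI[of _ g]) simp
  next
    case False
    define d where "d = complex_of_real (inverse (norm z)) *\<^sub>C z"
    have z: "z = complex_of_real (norm z) *\<^sub>C d"
      using False by (simp add: d_def scaleC_scaleC)
    have dS: "cinner d e = 0" "cinner e d = 0" if "e \<in> S" for e
      using zS[OF that] cinner_commute[of e z] by (simp_all add: d_def cinner_simps)
    have dd: "cinner d d = 1"
    proof -
      have "norm d = 1"
        unfolding d_def scaleC_of_real using False by simp
      then show ?thesis by (simp add: cinner_self)
    qed
    have "d \<notin> S" using dS dd by fastforce
    have on: "orthonormal (insert d S)"
      using S(2) dS dd by (auto simp: orthonormal_def)
    \<comment> \<open>The length of \<open>z\<close> moves into the first factor, so that the second
      factor is the unit vector \<open>d\<close>.\<close>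
    define k where "k = g(d := complex_of_real (norm z) *\<^sub>C x)"
    have tz: "t v z = t (complex_of_real (norm z) *\<^sub>C v) d" for v
      by (subst z) (simp add: t_scaleC_left t_scaleC_right)
    have g: "(\<Sum>e\<in>S. t (k e) e) = (\<Sum>e\<in>S. t (g e) e)"
      "(\<Sum>e\<in>S. t (A (k e)) e) = (\<Sum>e\<in>S. t (A (g e)) e)"
      using \<open>d \<notin> S\<close> by (auto intro!: sum.cong simp: k_def)
    have kd: "k d = complex_of_real (norm z) *\<^sub>C x" by (simp add: k_def)
    have "r *\<^sub>R p + q = (\<Sum>e\<in>insert d S. t (k e) e, \<Sum>e\<in>insert d S. t (A (k e)) e)"
      unfolding sum sum.insert[OF S(1) \<open>d \<notin> S\<close>] g kd blinfun_scaleC[OF A] tz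
      by (simp add: add.commute)
    with S(1) on show ?thesis by blast
  qed
qed

section \<open>Bounded operators on the tensor product\<close>

text \<open>In an orthonormal representation \<open>A\<close> acts on the coefficients alone, so
  summing the squares of \<open>norm (A (f e))\<close> gives the bound by \<open>norm A\<close>.
  That bound also shows the span \<open>\<Gamma>\<close> of the prescribed pairs to be the graph of
  a map.\<close>

lemma tensor_op_left_exists:
  fixes A :: "'h1 \<Rightarrow>\<^sub>L 'h1"
  assumes A: "clinear (blinfun_apply A)"
  obtains T where "clinear (blinfun_apply T)" and "\<And>x y. T (t x y) = t (A x) y"
    and "norm T \<le> norm A"
proof -
  define \<Gamma> where "\<Gamma> = span {(t x y, t (A x) y) | x y. True}"
  have "norm v \<le> norm A * norm u" if uv: "(u, v) \<in> \<Gamma>" for u v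
  proof -
    obtain S f where S: "finite S" "orthonormal S"
      and u: "u = (\<Sum>e\<in>S. t (f e) e)" and v: "v = (\<Sum>e\<in>S. t (A (f e)) e)"
      using orthonormal_representation[OF A uv[unfolded \<Gamma>_def]] by auto
    have "(norm v)\<^sup>2 = (\<Sum>e\<in>S. (norm (A (f e)))\<^sup>2)"
      unfolding v by (rule norm_orthonormal_sum[OF S])
    also have "\<dots> \<le> (\<Sum>e\<in>S. (norm A * norm (f e))\<^sup>2)"
      by (intro sum_mono power_mono norm_blinfun norm_ge_zero)
    also have "\<dots> = (norm A * norm u)\<^sup>2"
      unfolding u power_mult_distrib norm_orthonormal_sum[OF S] sum_distrib_left ..
    finally show ?thesis by (rule power2_le_imp_le) simp
  qed
  moreover have "subspace \<Gamma>" unfolding \<Gamma>_def by (rule subspace_span)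
  moreover have "closure (fst ` \<Gamma>) = UNIV"
  proof -
    have "fst ` \<Gamma> = span (fst ` {(t x y, t (A x) y) | x y. True})"
      unfolding \<Gamma>_def by (rule linear_span_image[OF linear_fst, symmetric])
    also have "fst ` {(t x y, t (A x) y) | x y. True} = {t x y | x y. True}" by force
    finally show ?thesis
      using closure_span_t by (simp only: complex_span_simple_tensors)
  qed
  ultimately obtain T :: "'k \<Rightarrow>\<^sub>L 'k"
    where T: "\<And>u v. (u, v) \<in> \<Gamma> \<Longrightarrow> T u = v" "norm T \<le> norm A"
    using blinfun_of_bounded_graph[of \<Gamma> "norm A"] norm_ge_zero by metis
  have Tt: "T (t x y) = t (A x) y" for x y
    by (rule T(1)) (auto simp: \<Gamma>_def intro!: span_base)
  have "T (c *\<^sub>C u) = c *\<^sub>C T u" for c u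
  proof -
    \<comment> \<open>The extension is a priori only real-linear; commutation with \<open>c\<close>
      is checked on simple tensors.\<close>
    have "T o\<^sub>L scaleC_op c id_blinfun = scaleC_op c T"
      by (rule blinfun_eqI_simple_tensors)
        (simp add: t_scaleC_left[symmetric] Tt blinfun_scaleC[OF A])
    from this[THEN arg_cong, of "\<lambda>R. R u"] show ?thesis by simp
  qed
  then have "clinear (blinfun_apply T)" by (simp add: clinear_blinfun_iff)
  with Tt T(2) show ?thesis using that by blast
qed

text \<open>Transfers statements about the first factor to the second.\<close>

lemma hilbert_tensor_swap: "hilbert_tensor (\<lambda>y x. t x y)"
proof -
  have "{t x y | y x. True} = {t x y | x y. True}" by auto
  then show ?thesis
    using tensor unfolding hilbert_tensor_def hilbert_tensor_product_def
    by (simp add: mult.commute)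
qed

text \<open>Factor \<open>A \<otimes> B\<close> as \<open>A \<otimes> 1\<close> after
  \<open>1 \<otimes> B\<close>, because orthonormal representations handle one factor at a
  time.\<close>

lemma tensor_op_exists:
  fixes A :: "'h1 \<Rightarrow>\<^sub>L 'h1" and B :: "'h2 \<Rightarrow>\<^sub>L 'h2"
  assumes A: "clinear (blinfun_apply A)" and B: "clinear (blinfun_apply B)"
  obtains T where "clinear (blinfun_apply T)" and "\<And>x y. T (t x y) = t (A x) (B y)"
    and "norm T \<le> norm A * norm B"
proof -
  obtain R where R: "clinear (blinfun_apply R)" "\<And>x y. R (t x y) = t (A x) y" "norm R \<le> norm A"
    using tensor_op_left_exists[OF A] by blast
  obtain S where S: "clinear (blinfun_apply S)" "\<And>x y. S (t x y) = t x (B y)" "norm S \<le> norm B"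
    by (rule hilbert_tensor.tensor_op_left_exists[OF hilbert_tensor_swap B]) (rule that)
  show ?thesis
  proof (rule that[of "R o\<^sub>L S"])
    show "clinear (blinfun_apply (R o\<^sub>L S))" using R(1) S(1) by (rule clinear_comp)
    show "(R o\<^sub>L S) (t x y) = t (A x) (B y)" for x y by (simp add: R(2) S(2))
    have "norm (R o\<^sub>L S) \<le> norm R * norm S" by (rule norm_blinfun_compose)
    also have "\<dots> \<le> norm A * norm B" using R(3) S(3) by (intro mult_mono) auto
    finally show "norm (R o\<^sub>L S) \<le> norm A * norm B" .
  qed
qed

lemma tensor_opI:
  fixes A :: "'h1 \<Rightarrow>\<^sub>L 'h1" and B :: "'h2 \<Rightarrow>\<^sub>L 'h2"
  assumes "clinear (blinfun_apply T)" and "\<And>x y. T (t x y) = t (A x) (B y)"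
  shows "tensor_op t A B = T"
  unfolding tensor_op_def
proof (rule the_equality)
  show "S = T" if "clinear (blinfun_apply S) \<and> (\<forall>x y. S (t x y) = t (A x) (B y))" for S
    by (rule blinfun_eqI_simple_tensors) (use that assms(2) in simp)
qed (use assms in blast)

lemma
  fixes A :: "'h1 \<Rightarrow>\<^sub>L 'h1" and B :: "'h2 \<Rightarrow>\<^sub>L 'h2"
  assumes A: "clinear (blinfun_apply A)" and B: "clinear (blinfun_apply B)"
  shows tensor_op_apply: "tensor_op t A B (t x y) = t (A x) (B y)"
    and norm_tensor_op: "norm (tensor_op t A B) \<le> norm A * norm B"
proof -
  obtain T where T: "clinear (blinfun_apply T)" "\<And>x y. T (t x y) = t (A x) (B y)"
    "norm T \<le> norm A * norm B"
    using tensor_op_exists[OF A B] by blast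
  from T(1,2) have "tensor_op t A B = T" by (rule tensor_opI)
  with T show "tensor_op t A B (t x y) = t (A x) (B y)"
    and "norm (tensor_op t A B) \<le> norm A * norm B" by simp_all
qed

lemma tensor_op_comp:
  assumes "clinear (blinfun_apply A)" "clinear (blinfun_apply B)"
    "clinear (blinfun_apply C)" "clinear (blinfun_apply D)"
  shows "tensor_op t A B o\<^sub>L tensor_op t C D = tensor_op t (A o\<^sub>L C) (B o\<^sub>L D)"
  by (rule blinfun_eqI_simple_tensors) (simp add: tensor_op_apply assms clinear_comp)

lemma tensor_op_zero_left: "clinear (blinfun_apply B) \<Longrightarrow> tensor_op t 0 B = 0"
  by (rule tensor_opI) (simp_all add: clinear_blinfun_iff)

lemma tensor_op_zero_right: "clinear (blinfun_apply A) \<Longrightarrow> tensor_op t A 0 = 0"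
  using hilbert_tensor.t_zero_left[OF hilbert_tensor_swap]
  by (intro tensor_opI) (simp_all add: clinear_blinfun_iff)

definition tensor_clinear_part :: "('h1 \<Rightarrow>\<^sub>L 'h1) \<Rightarrow> ('h2 \<Rightarrow>\<^sub>L 'h2) \<Rightarrow> 'k \<Rightarrow>\<^sub>L 'k"
  where "tensor_clinear_part A B = tensor_op t (clinear_part A) (clinear_part B)"

lemma tensor_clinear_part_eq:
  "clinear (blinfun_apply A) \<Longrightarrow> clinear (blinfun_apply B) \<Longrightarrow>
    tensor_clinear_part A B = tensor_op t A B"
  by (simp add: tensor_clinear_part_def clinear_part_id)

lemma tensor_clinear_part_apply:
  "tensor_clinear_part A B (t x y) = t (clinear_part A x) (clinear_part B y)"
  by (simp add: tensor_clinear_part_def tensor_op_apply clinear_clinear_part)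

lemma bounded_bilinear_tensor: "bounded_bilinear tensor_clinear_part"
proof -
  obtain K1 where K1: "0 \<le> K1" "\<And>A :: 'h1 \<Rightarrow>\<^sub>L 'h1. norm (clinear_part A) \<le> norm A * K1"
    using bounded_linear.nonneg_bounded[OF bounded_linear_clinear_part] by blast
  obtain K2 where K2: "0 \<le> K2" "\<And>A :: 'h2 \<Rightarrow>\<^sub>L 'h2. norm (clinear_part A) \<le> norm A * K2"
    using bounded_linear.nonneg_bounded[OF bounded_linear_clinear_part] by blast
  note lin = linear_add[OF bounded_linear.linear[OF bounded_linear_clinear_part]]
    linear_scale[OF bounded_linear.linear[OF bounded_linear_clinear_part]]
  interpret swap: hilbert_tensor "\<lambda>y x. t x y" by (rule hilbert_tensor_swap)
  show ?thesis
  proof (rule bounded_bilinear.intro)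
    show "\<exists>K. \<forall>A B. norm (tensor_clinear_part A B) \<le> norm A * norm B * K"
    proof (intro exI allI)
      fix A B
      have "norm (tensor_clinear_part A B) \<le> norm (clinear_part A) * norm (clinear_part B)"
        unfolding tensor_clinear_part_def
        by (intro norm_tensor_op clinear_clinear_part)
      also have "\<dots> \<le> (norm A * K1) * (norm B * K2)"
        using K1 K2 by (intro mult_mono) auto
      finally show "norm (tensor_clinear_part A B) \<le> norm A * norm B * (K1 * K2)"
        by (simp add: mult_ac)
    qed
  next
    fix A A' :: "'h1 \<Rightarrow>\<^sub>L 'h1" and B B' :: "'h2 \<Rightarrow>\<^sub>L 'h2" and r :: real
    show "tensor_clinear_part (A + A') B = tensor_clinear_part A B + tensor_clinear_part A' B"
      by (rule blinfun_eqI_simple_tensors)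
        (simp only: tensor_clinear_part_apply lin blinfun.add_left t_add_left)
    show "tensor_clinear_part A (B + B') = tensor_clinear_part A B + tensor_clinear_part A B'"
      by (rule blinfun_eqI_simple_tensors)
        (simp only: tensor_clinear_part_apply lin blinfun.add_left t_add_right)
    show "tensor_clinear_part (r *\<^sub>R A) B = r *\<^sub>R tensor_clinear_part A B"
      by (rule blinfun_eqI_simple_tensors)
        (simp only: tensor_clinear_part_apply lin blinfun.scaleR_left t_scaleR_left)
    show "tensor_clinear_part A (r *\<^sub>R B) = r *\<^sub>R tensor_clinear_part A B"
      by (rule blinfun_eqI_simple_tensors)
        (simp only: tensor_clinear_part_apply lin blinfun.scaleR_left swap.t_scaleR_left)
  qed
qed

end

section \<open>Projections onto holomorphic frames\<close>

text \<open>\<open>D\<close> is the limit of the difference quotients, which lie in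
  \<open>V\<close>; the assumption \<open>V\<close> is exactly the closure property that they
  require.\<close>

lemma derivative_in_closed_subspace:
  assumes f: "(f has_derivative (\<lambda>h. h *\<^sub>C D)) (at z)" and "open U" and "z \<in> U"
    and "\<And>x. x \<in> U \<Longrightarrow> f x \<in> V" and "closed V"
    and V: "\<And>c x y. x \<in> V \<Longrightarrow> y \<in> V \<Longrightarrow> c *\<^sub>C (x - y) \<in> V"
  shows "D \<in> V"
proof (rule Lim_in_closed_set[OF \<open>closed V\<close>])
  have ev: "\<forall>\<^sub>F x in at z. x \<in> U - {z}"
    using assms(2,3) by (rule eventually_at_in_open)
  show "\<forall>\<^sub>F x in at z. inverse (x - z) *\<^sub>C (f x - f z) \<in> V"
    using ev by eventually_elim (use assms(3,4) V in blast)
  have "((\<lambda>x. (f x - f z - (x - z) *\<^sub>C D) /\<^sub>R norm (x - z)) \<longlongrightarrow> 0) (at z)"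
    using f by (simp only: has_derivative_at_within)
  then have "((\<lambda>x. norm ((f x - f z - (x - z) *\<^sub>C D) /\<^sub>R norm (x - z))) \<longlongrightarrow> 0) (at z)"
    by (rule tendsto_norm_zero)
  moreover have "\<forall>\<^sub>F x in at z. norm ((f x - f z - (x - z) *\<^sub>C D) /\<^sub>R norm (x - z))
      = norm (inverse (x - z) *\<^sub>C (f x - f z) - D)"
    using ev
  proof eventually_elim
    case (elim x)
    then have "inverse (x - z) *\<^sub>C (f x - f z) - D
        = inverse (x - z) *\<^sub>C (f x - f z - (x - z) *\<^sub>C D)"
      by (simp add: complex_vector.scale_right_diff_distrib scaleC_scaleC)
    then show ?case by (simp only: norm_scaleC norm_scaleR norm_inverse abs_inverse abs_norm_cancel)
  qed
  ultimately have "((\<lambda>x. norm (inverse (x - z) *\<^sub>C (f x - f z) - D)) \<longlongrightarrow> 0) (at z)"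
    by (rule Lim_transform_eventually)
  then show "((\<lambda>x. inverse (x - z) *\<^sub>C (f x - f z)) \<longlongrightarrow> D) (at z)"
    by (rule LIM_zero_cancel[OF tendsto_norm_zero_cancel])
qed (rule at_neq_bot)

text \<open>Frames live in the ambient space but the projections act on the space of
  \<open>\<sigma>\<close>, so frames must be pulled back. Closedness of the range gives the
  derivative of \<open>s\<close> a preimage \<open>d\<close>, and the isometry carries the remainder
  estimate over unchanged.\<close>

lemma holomorphic_map_on_isometry_vimage:
  assumes lin: "clinear \<iota>" and iso: "\<And>x y. cinner (\<iota> x) (\<iota> y) = cinner x y"
    and "closed (range \<iota>)" and "open U" and s: "holomorphic_map_on s U"
    and \<sigma>: "\<And>z. z \<in> U \<Longrightarrow> \<iota> (\<sigma> z) = s z"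
  shows "holomorphic_map_on \<sigma> U"
  unfolding holomorphic_map_on_def
proof
  have add: "\<iota> (x + y) = \<iota> x + \<iota> y" and scale: "\<iota> (c *\<^sub>C x) = c *\<^sub>C \<iota> x" for x y c
    using lin by (simp_all add: clinear_iff)
  have scaleR: "\<iota> (r *\<^sub>R x) = r *\<^sub>R \<iota> x" for r x
    using scale[of "complex_of_real r" x] by (simp only: scaleC_of_real)
  have diff: "\<iota> (x - y) = \<iota> x - \<iota> y" for x y
    using add[of "x - y" y] by simp
  have norm: "norm (\<iota> x) = norm x" for x
  proof -
    have "complex_of_real ((norm (\<iota> x))\<^sup>2) = complex_of_real ((norm x)\<^sup>2)"
      using iso[of x x] by (simp only: cinner_self)
    then have "(norm (\<iota> x))\<^sup>2 = (norm x)\<^sup>2" using of_real_eq_iff by blast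
    then show ?thesis by (simp add: power2_eq_iff_nonneg)
  qed
  fix z assume z: "z \<in> U"
  obtain D where sz: "(s has_derivative (\<lambda>h. h *\<^sub>C D)) (at z)"
    using holomorphic_map_on_has_derivative[OF s \<open>open U\<close> z] by blast
  have "D \<in> range \<iota>"
  proof (rule derivative_in_closed_subspace[OF sz \<open>open U\<close> z _ \<open>closed (range \<iota>)\<close>])
    show "s x \<in> range \<iota>" if "x \<in> U" for x using \<sigma>[OF that] by (metis rangeI)
    show "c *\<^sub>C (x - y) \<in> range \<iota>" if "x \<in> range \<iota>" "y \<in> range \<iota>" for c x y
      using that by (auto simp flip: scale diff)
  qed
  then obtain d where d: "D = \<iota> d" by blast
  have "((\<lambda>x. (s x - s z - (x - z) *\<^sub>C D) /\<^sub>R norm (x - z)) \<longlongrightarrow> 0) (at z)"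
    using sz by (simp only: has_derivative_at_within)
  then have "((\<lambda>x. norm ((s x - s z - (x - z) *\<^sub>C D) /\<^sub>R norm (x - z))) \<longlongrightarrow> 0) (at z)"
    by (rule tendsto_norm_zero)
  moreover have "\<forall>\<^sub>F x in at z. norm ((s x - s z - (x - z) *\<^sub>C D) /\<^sub>R norm (x - z))
      = norm ((\<sigma> x - \<sigma> z - (x - z) *\<^sub>C d) /\<^sub>R norm (x - z))"
    using eventually_at_in_open[OF \<open>open U\<close> z]
  proof eventually_elim
    case (elim x)
    then have "(s x - s z - (x - z) *\<^sub>C D) /\<^sub>R norm (x - z)
        = \<iota> ((\<sigma> x - \<sigma> z - (x - z) *\<^sub>C d) /\<^sub>R norm (x - z))"
      using z by (simp only: diff scale scaleR d \<sigma> DiffD1)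
    then show ?case by (simp only: norm)
  qed
  ultimately have "((\<lambda>x. norm ((\<sigma> x - \<sigma> z - (x - z) *\<^sub>C d) /\<^sub>R norm (x - z))) \<longlongrightarrow> 0) (at z)"
    by (rule Lim_transform_eventually)
  then have "(\<sigma> has_derivative (\<lambda>h. h *\<^sub>C d)) (at z)"
    unfolding has_derivative_at_within
    by (rule conjI[OF bounded_bilinear.bounded_linear_left[OF bounded_bilinear_scaleC]
          tendsto_norm_zero_cancel])
  then show "\<exists>D. (\<sigma> has_derivative (\<lambda>h. h *\<^sub>C D)) (at z within U)"
    unfolding at_within_open[OF z \<open>open U\<close>] ..
qed

section \<open>Orthogonal projections and Gram-Schmidt\<close>

lemma orthogonal_projection_onto_fixes:
  assumes "orthogonal_projection_onto p M" and "x \<in> M" shows "p x = x"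
proof -
  obtain y where y: "x = p y" using assms by (auto simp: orthogonal_projection_onto_def)
  have "(p o\<^sub>L p) y = p y" using assms(1) by (simp add: orthogonal_projection_onto_def)
  then show ?thesis by (simp add: y)
qed

lemma orthogonal_projection_onto_in:
  "orthogonal_projection_onto p M \<Longrightarrow> p x \<in> M"
  by (auto simp: orthogonal_projection_onto_def)

text \<open>Each projection fixes the range of the other, so \<open>q p = p\<close> and
  \<open>p q = q\<close>; self-adjointness then identifies them.\<close>

lemma orthogonal_projection_onto_unique:
  assumes p: "orthogonal_projection_onto p M" and q: "orthogonal_projection_onto q M"
  shows "p = q"
proof (rule blinfun_eqI, rule cinner_eqI)
  fix x y
  have "cinner (p x) y = cinner (q (p x)) y"
    using orthogonal_projection_onto_fixes[OF q orthogonal_projection_onto_in[OF p]] by simp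
  also have "\<dots> = cinner x (p (q y))"
    using p q by (simp add: orthogonal_projection_onto_def)
  also have "p (q y) = q y"
    by (rule orthogonal_projection_onto_fixes[OF p orthogonal_projection_onto_in[OF q]])
  also have "cinner x (q y) = cinner (q x) y"
    using q by (simp add: orthogonal_projection_onto_def)
  finally show "cinner (p x) y = cinner (q x) y" .
qed

text \<open>\<open>r\<close> is orthogonal to the range of \<open>q\<close>, so the cross terms in
  the square of the sum vanish. The scalar product of \<open>s\<close> with \<open>r\<close> equals
  \<open>c\<close>, whence the new operator maps \<open>s\<close> to
  \<open>q s + r = s\<close>.\<close>

lemma gram_schmidt_step:
  assumes q: "orthogonal_projection_onto q (complex_vector.span B)"
    and s: "s \<notin> complex_vector.span B"
  defines "r \<equiv> s - q s"
  shows "r \<noteq> 0"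
    and "orthogonal_projection_onto (q + rank_one (inverse (cinner r r) *\<^sub>C r) r)
      (complex_vector.span (insert s B))"
proof -
  have clin: "clinear (blinfun_apply q)" and qq: "q (q x) = q x"
    and sa: "cinner (q x) y = cinner x (q y)" for x y
    using q orthogonal_projection_onto_fixes[OF q orthogonal_projection_onto_in[OF q]]
    by (simp_all add: orthogonal_projection_onto_def)
  have q_in: "q x \<in> complex_vector.span B" for x
    by (rule orthogonal_projection_onto_in[OF q])
  show "r \<noteq> 0" using s q_in[of s] by (auto simp: r_def)
  define c where "c = cinner r r"
  have c: "c \<noteq> 0" using \<open>r \<noteq> 0\<close> by (simp add: c_def)
  define p where "p = q + rank_one (inverse c *\<^sub>C r) r"
  have p: "p x = q x + (inverse c * cinner x r) *\<^sub>C r" for x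
    by (simp add: p_def blinfun.add_left scaleC_scaleC mult.commute)
  have qr: "q r = 0" by (simp add: r_def blinfun.diff_right qq)
  have qr': "cinner (q x) r = 0" for x by (simp add: sa qr)
  have sr: "cinner s r = c"
    using qr'[of s] by (simp add: c_def r_def cinner_diff_left)
  have pclin: "clinear (blinfun_apply p)"
    unfolding p_def by (rule clinear_add[OF clin clinear_rank_one])
  have pr: "p r = r" using c by (simp add: p qr c_def[symmetric])
  have pq: "p (q x) = q x" for x by (simp add: p qq qr')
  have "p o\<^sub>L p = p"
  proof (rule blinfun_eqI)
    fix x
    have "p (p x) = p (q x) + (inverse c * cinner x r) *\<^sub>C p r"
      unfolding p[of x] by (simp add: blinfun.add_right blinfun_scaleC[OF pclin])
    then show "(p o\<^sub>L p) x = p x" by (simp add: pq pr p[of x])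
  qed
  moreover have "cinner (p x) y = cinner x (p y)" for x y
  proof -
    have "cnj c = c" by (simp add: c_def cinner_self)
    then show ?thesis
      unfolding p by (simp add: cinner_simps sa cinner_commute[of y r])
  qed
  moreover have "range p = complex_vector.span (insert s B)"
  proof
    have incl: "complex_vector.span B \<subseteq> complex_vector.span (insert s B)"
      by (rule complex_vector.span_mono) auto
    have "s \<in> complex_vector.span (insert s B)" by (rule complex_vector.span_base) simp
    then have "r \<in> complex_vector.span (insert s B)"
      unfolding r_def using q_in incl by (intro complex_vector.span_diff) auto
    then show "range p \<subseteq> complex_vector.span (insert s B)"
      using q_in incl unfolding p
      by (auto intro!: complex_vector.span_add complex_vector.span_scale)
    have "p s = q s + r" using c by (simp add: p sr)
    then have ps: "p s = s" by (simp add: r_def)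
    have pB: "p b = b" if "b \<in> B" for b
      using pq[of b] orthogonal_projection_onto_fixes[OF q complex_vector.span_base[OF that]]
      by simp
    have fixed: "p x = x" if "x \<in> complex_vector.span (insert s B)" for x
      using that
    proof (induction rule: complex_vector.span_induct_alt)
      case (step a x y)
      then show ?case using ps pB by (auto simp: blinfun.add_right blinfun_scaleC[OF pclin])
    qed simp
    show "complex_vector.span (insert s B) \<subseteq> range p"
      using fixed by (metis rangeI subsetI)
  qed
  ultimately show "orthogonal_projection_onto (q + rank_one (inverse (cinner r r) *\<^sub>C r) r)
      (complex_vector.span (insert s B))"
    using pclin unfolding orthogonal_projection_onto_def p_def c_def by blast
qed

text \<open>Each step uses sums, bilinear operations and the inverse of \<open>cinner r r\<close>,
  which is nonzero because the new vector lies outside the span of its predecessors. Independence is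
  assumed in this triangular form since the induction consumes it one vector at a time.\<close>

lemma smooth_orthogonal_projection:
  fixes \<sigma> :: "nat \<Rightarrow> complex \<Rightarrow> 'h::chilbert_space"
  assumes "open U" and "\<And>k. k < n \<Longrightarrow> smooth_map_on U (\<sigma> k)"
    and "\<And>k z. k < n \<Longrightarrow> z \<in> U \<Longrightarrow> \<sigma> k z \<notin> complex_vector.span ((\<lambda>j. \<sigma> j z) ` {..<k})"
  shows "\<exists>Q. smooth_map_on U Q \<and> (\<forall>z\<in>U.
    orthogonal_projection_onto (Q z) (complex_vector.span ((\<lambda>j. \<sigma> j z) ` {..<n})))"
  using assms(2,3)
proof (induction n)
  case 0
  have "orthogonal_projection_onto (0 :: 'h \<Rightarrow>\<^sub>L 'h) {0}"
    by (auto simp: orthogonal_projection_onto_def clinear_blinfun_iff)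
  then show ?case
    by (intro exI[of _ "\<lambda>z. 0"]) (simp add: smooth_map_on_zero complex_vector.span_empty)
next
  case (Suc n)
  then obtain Q where Q: "smooth_map_on U Q"
    "\<And>z. z \<in> U \<Longrightarrow>
      orthogonal_projection_onto (Q z) (complex_vector.span ((\<lambda>j. \<sigma> j z) ` {..<n}))"
    by (metis less_Suc_eq)
  define r where "r z = \<sigma> n z - Q z (\<sigma> n z)" for z
  note step = gram_schmidt_step[OF Q(2) Suc.prems(2)[OF lessI], folded r_def]
  have \<sigma>: "smooth_map_on U (\<sigma> n)" by (rule Suc.prems(1)) simp
  have r: "smooth_map_on U r"
    unfolding r_def[abs_def]
    by (rule smooth_map_on_diff[OF \<sigma> smooth_map_on_bilinear[OF bounded_bilinear_blinfun_apply Q(1) \<sigma>]])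
  have c: "smooth_map_on U (\<lambda>z. inverse (cinner (r z) (r z)))"
    using step(1)
    by (intro smooth_map_on_inverse smooth_map_on_bilinear[OF bounded_bilinear_cinner] r) auto
  have "smooth_map_on U (\<lambda>z. Q z + rank_one (inverse (cinner (r z) (r z)) *\<^sub>C r z) (r z))"
    by (rule smooth_map_on_add[OF Q(1) smooth_map_on_bilinear[OF bounded_bilinear_rank_one
            smooth_map_on_bilinear[OF bounded_bilinear_scaleC c r] r]])
  with step(2) show ?case
    by (intro exI[of _ "\<lambda>z. Q z + rank_one (inverse (cinner (r z) (r z)) *\<^sub>C r z) (r z)"])
      (simp add: lessThan_Suc)
qed

text \<open>The derivative of \<open>P z (\<sigma> k z) = \<sigma> k z\<close> shows that \<open>d_wbar P\<close> kills the frame.\<close>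

lemma d_wbar_projection_onto_frame:
  assumes "open U" and P: "smooth_map_on U P"
    and proj: "\<And>z. z \<in> U \<Longrightarrow>
      orthogonal_projection_onto (P z) (complex_vector.span ((\<lambda>k. \<sigma> k z) ` {..<n}))"
    and hol: "\<And>k. k < n \<Longrightarrow> holomorphic_map_on (\<sigma> k) U" and w: "w \<in> U"
  shows "d_wbar P w o\<^sub>L P w = 0"
proof -
  have clin: "clinear (blinfun_apply (P z))" if "z \<in> U" for z
    using proj[OF that] by (simp add: orthogonal_projection_onto_def)
  have dclin: "clinear (blinfun_apply (d_wbar P w))"
    using clinear_wirtinger[OF P \<open>open U\<close> w clin] by blast
  obtain a b where F: "(P has_derivative (\<lambda>h. Re h *\<^sub>R a + Im h *\<^sub>R b)) (at w)"
    using P w by (rule smooth_map_on_has_derivative)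
  have frame: "d_wbar P w (\<sigma> k w) = 0" if k: "k < n" for k
  proof -
    obtain D where S: "(\<sigma> k has_derivative (\<lambda>h. h *\<^sub>C D)) (at w)"
      using holomorphic_map_on_has_derivative[OF hol[OF k] \<open>open U\<close> w] by blast
    have "((\<lambda>z. P z (\<sigma> k z)) has_derivative
        (\<lambda>h. P w (h *\<^sub>C D) + (Re h *\<^sub>R a + Im h *\<^sub>R b) (\<sigma> k w))) (at w)"
      by (rule bounded_bilinear.FDERIV[OF bounded_bilinear_blinfun_apply F S])
    moreover have "P z (\<sigma> k z) = \<sigma> k z" if "z \<in> U" for z
      using k by (intro orthogonal_projection_onto_fixes[OF proj[OF that]]
          complex_vector.span_base) auto
    ultimately have "(\<sigma> k has_derivative
        (\<lambda>h. P w (h *\<^sub>C D) + (Re h *\<^sub>R a + Im h *\<^sub>R b) (\<sigma> k w))) (at w)"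
      by (rule has_derivative_transform_within_open[OF _ \<open>open U\<close> w])
    from has_derivative_unique[OF this S]
    have *: "P w (h *\<^sub>C D) + (Re h *\<^sub>R a + Im h *\<^sub>R b) (\<sigma> k w) = h *\<^sub>C D" for h
      by (rule fun_cong)
    \<comment> \<open>Holomorphy of the frame makes the value of \<open>b\<close> on it
      \<open>\<i>\<close> times that of \<open>a\<close>, so \<open>a + scaleC_op \<i> b\<close>
      vanishes there.\<close>
    have a: "a (\<sigma> k w) = D - P w (D)"
      using *[of 1] by (simp add: algebra_simps)
    have "b (\<sigma> k w) = \<i> *\<^sub>C D - P w (\<i> *\<^sub>C D)"
      using *[of \<i>] by (simp add: eq_diff_eq add.commute)
    then have b: "b (\<sigma> k w) = \<i> *\<^sub>C (D - P w (D))"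
      by (simp add: blinfun_scaleC[OF clin[OF w]] complex_vector.scale_right_diff_distrib)
    show ?thesis
      unfolding wirtinger(2)[OF F] blinfun.scaleR_left blinfun.add_left scaleC_op_apply a b
      by (simp add: scaleC_scaleC)
  qed
  have "d_wbar P w x = 0" if "x \<in> complex_vector.span ((\<lambda>k. \<sigma> k w) ` {..<n})" for x
    using that
  proof (induction rule: complex_vector.span_induct_alt)
    case (step c x y)
    then show ?case using frame by (auto simp: blinfun.add_right blinfun_scaleC[OF dclin])
  qed simp
  then show ?thesis
    using orthogonal_projection_onto_in[OF proj[OF w]] by (intro blinfun_eqI) simp
qed

section \<open>Holomorphic curves of projections\<close>

text \<open>The identities are required on an open set because they will be differentiated;
  \<open>U\<close> is meant to be a neighbourhood that carries a frame.\<close>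

locale holomorphic_curve =
  fixes U :: "complex set" and P :: "complex \<Rightarrow> 'h::chilbert_space \<Rightarrow>\<^sub>L 'h"
  assumes open_domain: "open U"
    and smooth: "smooth_map_on U P"
    and clin: "z \<in> U \<Longrightarrow> clinear (blinfun_apply (P z))"
    and idem: "z \<in> U \<Longrightarrow> P z o\<^sub>L P z = P z"
    and selfadjoint: "z \<in> U \<Longrightarrow> cinner (P z x) y = cinner x (P z y)"
    and d_wbar_comp: "z \<in> U \<Longrightarrow> d_wbar P z o\<^sub>L P z = 0"

lemma holomorphic_curve_subset:
  "holomorphic_curve U P \<Longrightarrow> open V \<Longrightarrow> V \<subseteq> U \<Longrightarrow> holomorphic_curve V P"
  unfolding holomorphic_curve_def by (auto intro: smooth_map_on_subset)

text \<open>Nothing is assumed about how \<open>P\<close> depends on the point. Its smoothness comes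
  from uniqueness of orthogonal projections, which identifies it on \<open>U\<close> with the one
  built from the pulled-back frame.\<close>

lemma bundle_projection_holomorphic_curve:
  fixes \<iota> :: "'h::chilbert_space \<Rightarrow> 'a::chilbert_space"
  assumes "hermitian_holomorphic_bundle \<Omega> E" and "closed_span_of_fibres \<Omega> E \<iota>"
    and proj: "\<And>z. z \<in> \<Omega> \<Longrightarrow> orthogonal_projection_onto (P z) (\<iota> -` E z)"
    and "w \<in> \<Omega>"
  shows "\<exists>U. w \<in> U \<and> U \<subseteq> \<Omega> \<and> holomorphic_curve U P"
proof -
  have lin: "clinear \<iota>" and iso: "\<And>x y. cinner (\<iota> x) (\<iota> y) = cinner x y"
    and range: "range \<iota> = closure (complex_vector.span (\<Union>w\<in>\<Omega>. E w))"
    using assms(2) by (simp_all add: closed_span_of_fibres_def)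
  obtain n where "\<forall>w\<^sub>0\<in>\<Omega>. \<exists>U s. open U \<and> w\<^sub>0 \<in> U \<and> U \<subseteq> \<Omega> \<and>
      (\<forall>k<n::nat. holomorphic_map_on (s k) U) \<and>
      (\<forall>w\<in>U. inj_on (\<lambda>k. s k w) {..<n} \<and>
        complex_vector.independent ((\<lambda>k. s k w) ` {..<n}) \<and>
        complex_vector.span ((\<lambda>k. s k w) ` {..<n}) = E w)"
    using assms(1) unfolding hermitian_holomorphic_bundle_def by (rule exE)
  from bspec[OF this assms(4)] obtain U s where U: "open U" "w \<in> U" "U \<subseteq> \<Omega>"
    and s: "\<forall>k<n. holomorphic_map_on (s k) U" "\<forall>z\<in>U. inj_on (\<lambda>k. s k z) {..<n} \<and>
        complex_vector.independent ((\<lambda>k. s k z) ` {..<n}) \<and>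
        complex_vector.span ((\<lambda>k. s k z) ` {..<n}) = E z"
    by (elim exE conjE) (rule that)
  have hol: "holomorphic_map_on (s k) U" if "k < n" for k using s(1) that by blast
  have frame: "inj_on (\<lambda>k. s k z) {..<n}"
      "complex_vector.independent ((\<lambda>k. s k z) ` {..<n})"
      "complex_vector.span ((\<lambda>k. s k z) ` {..<n}) = E z" if "z \<in> U" for z
    using s(2) that by blast+
  define \<sigma> where "\<sigma> k z = inv \<iota> (s k z)" for k z
  have \<sigma>: "\<iota> (\<sigma> k z) = s k z" if "k < n" "z \<in> U" for k z
  proof -
    have "s k z \<in> E z"
      unfolding frame(3)[OF that(2), symmetric]
      by (rule complex_vector.span_base) (use that(1) in blast)
    then have "s k z \<in> complex_vector.span (\<Union>w\<in>\<Omega>. E w)"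
      using that(2) U(3) by (intro complex_vector.span_base) blast
    then have "s k z \<in> range \<iota>"
      unfolding range using closure_subset by (rule rev_subsetD)
    then show ?thesis unfolding \<sigma>_def by (rule f_inv_into_f)
  qed
  have \<sigma>_hol: "holomorphic_map_on (\<sigma> k) U" if "k < n" for k
    by (rule holomorphic_map_on_isometry_vimage[OF lin iso _ U(1) hol[OF that] \<sigma>[OF that]])
      (simp add: range)
  have "inj \<iota>"
  proof (rule injI)
    fix x y assume eq: "\<iota> x = \<iota> y"
    have "cinner x v = cinner y v" for v
      unfolding iso[symmetric] eq ..
    then show "x = y" by (rule cinner_eqI)
  qed
  have span: "\<iota> ` complex_vector.span ((\<lambda>j. \<sigma> j z) ` {..<k})
      = complex_vector.span ((\<lambda>j. s j z) ` {..<k})" if "z \<in> U" "k \<le> n" for z k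
  proof -
    have "\<iota> ` (\<lambda>j. \<sigma> j z) ` {..<k} = (\<lambda>j. s j z) ` {..<k}"
      unfolding image_image using that \<sigma> by (intro image_cong) auto
    then show ?thesis
      using module_hom.span_image[OF lin[unfolded Vector_Spaces.linear_def, THEN conjunct2, THEN conjunct2]]
      by metis
  qed
  have fibre: "\<iota> -` E z = complex_vector.span ((\<lambda>j. \<sigma> j z) ` {..<n})" if "z \<in> U" for z
    using span[OF that order_refl] frame(3)[OF that] \<open>inj \<iota>\<close> by (metis inj_vimage_image_eq)
  have indep: "\<sigma> k z \<notin> complex_vector.span ((\<lambda>j. \<sigma> j z) ` {..<k})" if "k < n" "z \<in> U" for k z
  proof
    assume "\<sigma> k z \<in> complex_vector.span ((\<lambda>j. \<sigma> j z) ` {..<k})"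
    then have "s k z \<in> complex_vector.span ((\<lambda>j. s j z) ` {..<k})"
      using span[OF that(2), of k] that(1) \<sigma>[OF that] by (metis imageI less_imp_le)
    \<comment> \<open>Injectivity in the index ensures that \<open>s k z\<close> does not occur
      among the earlier vectors.\<close>
    moreover have "(\<lambda>j. s j z) ` {..<k} \<subseteq> (\<lambda>j. s j z) ` {..<n} - {s k z}"
      using that frame(1)[OF that(2)] by (auto simp: inj_on_def)
    ultimately have "s k z \<in> complex_vector.span ((\<lambda>j. s j z) ` {..<n} - {s k z})"
      using complex_vector.span_mono by blast
    then show False
      using frame(2)[OF that(2)] that(1) unfolding complex_vector.dependent_def by blast
  qed
  have proj': "orthogonal_projection_onto (P z) (complex_vector.span ((\<lambda>j. \<sigma> j z) ` {..<n}))"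
    if "z \<in> U" for z
    using proj[of z] U(3) that fibre[OF that] by auto
  obtain Q where Q: "smooth_map_on U Q" "\<And>z. z \<in> U \<Longrightarrow>
      orthogonal_projection_onto (Q z) (complex_vector.span ((\<lambda>j. \<sigma> j z) ` {..<n}))"
    using smooth_orthogonal_projection[OF U(1) holomorphic_imp_smooth[OF \<sigma>_hol U(1)] indep]
    by blast
  have P: "smooth_map_on U P"
    using Q(1) U(1) orthogonal_projection_onto_unique[OF Q(2) proj'] by (rule smooth_map_on_cong)
  have "holomorphic_curve U P"
    by (rule holomorphic_curve.intro[OF U(1) P _ _ _
          d_wbar_projection_onto_frame[OF U(1) P proj' \<sigma>_hol]])
      (use proj' in \<open>auto simp: orthogonal_projection_onto_def\<close>)
  with U show ?thesis by blast
qed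

section \<open>Curvature of tensor products\<close>

lemmas comp_simps =
  bounded_bilinear.add_left[OF bounded_bilinear_blinfun_compose]
  bounded_bilinear.add_right[OF bounded_bilinear_blinfun_compose]
  bounded_bilinear.zero_left[OF bounded_bilinear_blinfun_compose]
  bounded_bilinear.zero_right[OF bounded_bilinear_blinfun_compose]

lemma blinfun_compose_assoc: "(A o\<^sub>L B) o\<^sub>L C = A o\<^sub>L (B o\<^sub>L C)"
  by (rule blinfun_eqI) simp

context holomorphic_curve
begin

lemma smooth_d_w: "smooth_map_on U (d_w P)" and smooth_d_wbar: "smooth_map_on U (d_wbar P)"
  using smooth_map_on_wirtinger[OF smooth open_domain] by blast+

lemma
  assumes "z \<in> U"
  shows clin_d_w: "clinear (blinfun_apply (d_w P z))"
    and clin_d_wbar: "clinear (blinfun_apply (d_wbar P z))"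
  using clinear_wirtinger[OF smooth open_domain assms clin] by blast+

text \<open>Differentiating self-adjointness shows that both real partial derivatives of
  \<open>P\<close> are self-adjoint, so \<open>d_w P\<close> and \<open>d_wbar P\<close> are adjoint
  to each other. The claim is then the adjoint of \<open>d_wbar_comp\<close>, expressed through
  scalar products.\<close>

lemma comp_d_w:
  assumes z: "z \<in> U" shows "P z o\<^sub>L d_w P z = 0"
proof (rule blinfun_eqI, rule cinner_eqI)
  fix x y
  obtain a b where D: "(P has_derivative (\<lambda>h. Re h *\<^sub>R a + Im h *\<^sub>R b)) (at z)"
    using smooth z by (rule smooth_map_on_has_derivative)
  \<comment> \<open>A bounded real-linear functional of \<open>A\<close> measuring the failure of
    self-adjointness; it vanishes along \<open>P\<close>, hence on the derivatives.\<close>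
  define l where "l u v A = cinner (A u) v - cinner u (A v)" for u v and A :: "'h \<Rightarrow>\<^sub>L 'h"
  have l: "bounded_linear (l u v)" for u v
    unfolding l_def
    by (intro bounded_linear_sub
        bounded_linear_compose[OF bounded_bilinear.bounded_linear_left[OF bounded_bilinear_cinner]]
        bounded_linear_compose[OF bounded_bilinear.bounded_linear_right[OF bounded_bilinear_cinner]]
        bounded_bilinear.bounded_linear_left[OF bounded_bilinear_blinfun_apply])
  have "l u v a = 0 \<and> l u v b = 0" for u v
  proof -
    have "((\<lambda>z. l u v (P z)) has_derivative (\<lambda>h. l u v (Re h *\<^sub>R a + Im h *\<^sub>R b))) (at z)"
      by (rule bounded_linear.has_derivative[OF l D])
    moreover have "l u v (P z) = 0" if "z \<in> U" for z
      using selfadjoint[OF that] by (simp add: l_def)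
    ultimately have "((\<lambda>z. 0) has_derivative (\<lambda>h. l u v (Re h *\<^sub>R a + Im h *\<^sub>R b))) (at z)"
      by (rule has_derivative_transform_within_open[OF _ open_domain z])
    from has_derivative_unique[OF this has_derivative_const]
    have *: "l u v (Re h *\<^sub>R a + Im h *\<^sub>R b) = 0" for h by (rule fun_cong)
    from *[of 1] *[of \<i>] show ?thesis by simp
  qed
  then have ab: "cinner (a u) v = cinner u (a v)" "cinner (b u) v = cinner u (b v)" for u v
    by (simp_all add: l_def)
  have adj: "cinner (d_w P z u) v = cinner u (d_wbar P z v)" for u v
    unfolding wirtinger[OF D]
    by (simp add: blinfun.bilinear_simps cinner_simps ab)
  have "cinner ((P z o\<^sub>L d_w P z) x) y = cinner x ((d_wbar P z o\<^sub>L P z) y)"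
    by (simp add: selfadjoint[OF z] adj)
  then show "cinner ((P z o\<^sub>L d_w P z) x) y = cinner (blinfun_apply 0 x) y"
    by (simp add: d_wbar_comp[OF z])
qed

text \<open>Differentiate \<open>P o\<^sub>L P = P\<close>; in each of the two product rules one
  term is already known to vanish.\<close>

lemma
  assumes z: "z \<in> U"
  shows d_w_comp: "d_w P z o\<^sub>L P z = d_w P z"
    and comp_d_wbar: "P z o\<^sub>L d_wbar P z = d_wbar P z"
proof -
  have "d_w (\<lambda>z. P z o\<^sub>L P z) z = d_w P z" "d_wbar (\<lambda>z. P z o\<^sub>L P z) z = d_wbar P z"
    by (rule wirtinger_cong[OF smooth open_domain _ z], simp add: idem)+
  then show "d_w P z o\<^sub>L P z = d_w P z" and "P z o\<^sub>L d_wbar P z = d_wbar P z"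
    using wirtinger_comp[OF smooth smooth open_domain z clin clin] comp_d_w[OF z]
      d_wbar_comp[OF z] by simp_all
qed

text \<open>A step in \<open>w\<close> puts \<open>P\<close> on the left by construction. On the
  right, differentiating \<open>K o\<^sub>L P = K\<close> leaves the extra term
  \<open>K o\<^sub>L d_w P\<close>, and inserting \<open>P\<close> between its factors makes it
  zero. Steps in the conjugate variable are the mirror image.\<close>

lemma curvature_deriv_props:
  "smooth_map_on U (curvature_deriv \<sigma> P) \<and> (\<forall>z\<in>U.
    clinear (blinfun_apply (curvature_deriv \<sigma> P z)) \<and>
    P z o\<^sub>L curvature_deriv \<sigma> P z = curvature_deriv \<sigma> P z \<and>
    curvature_deriv \<sigma> P z o\<^sub>L P z = curvature_deriv \<sigma> P z)"
proof (induction \<sigma>)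
  case Nil
  have "smooth_map_on U (\<lambda>z. d_wbar P z o\<^sub>L d_w P z)"
    by (rule smooth_map_on_bilinear[OF bounded_bilinear_blinfun_compose smooth_d_wbar smooth_d_w])
  moreover have "P z o\<^sub>L (d_wbar P z o\<^sub>L d_w P z) = d_wbar P z o\<^sub>L d_w P z"
    "(d_wbar P z o\<^sub>L d_w P z) o\<^sub>L P z = d_wbar P z o\<^sub>L d_w P z" if "z \<in> U" for z
    using comp_d_wbar[OF that] d_w_comp[OF that]
    by (simp_all add: blinfun_compose_assoc flip: blinfun_compose_assoc[of "P z"])
  ultimately show ?case
    by (simp add: clinear_comp[OF clin_d_wbar clin_d_w]
        del: blinfun_apply_blinfun_compose)
next
  case (Cons d \<sigma>)
  define K where "K = curvature_deriv \<sigma> P"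
  have K: "smooth_map_on U K" and Kc: "\<And>z. z \<in> U \<Longrightarrow> clinear (blinfun_apply (K z))"
    and PK: "\<And>z. z \<in> U \<Longrightarrow> P z o\<^sub>L K z = K z" and KP: "\<And>z. z \<in> U \<Longrightarrow> K z o\<^sub>L P z = K z"
    using Cons by (simp_all add: K_def)
  note dK = smooth_map_on_wirtinger[OF K open_domain]
  have dKc: "clinear (blinfun_apply (d_w K z))" "clinear (blinfun_apply (d_wbar K z))"
    if "z \<in> U" for z
    using clinear_wirtinger[OF K open_domain that Kc] by blast+
  show ?case
  proof (cases d)
    case Dir_w
    have "d_w K z o\<^sub>L P z = d_w K z" if z: "z \<in> U" for z
    proof -
      have "K z o\<^sub>L d_w P z = K z o\<^sub>L (P z o\<^sub>L d_w P z)"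
        by (simp add: KP[OF z] flip: blinfun_compose_assoc)
      then have "K z o\<^sub>L d_w P z = 0" by (simp add: comp_d_w[OF z] comp_simps)
      then show ?thesis
        using wirtinger_comp(1)[OF K smooth open_domain z Kc clin]
          wirtinger_cong(1)[OF K open_domain KP[symmetric] z] by simp
    qed
    moreover have "P z o\<^sub>L (P z o\<^sub>L A) = P z o\<^sub>L A" if "z \<in> U" for z and A :: "'h \<Rightarrow>\<^sub>L 'h"
      by (simp add: idem[OF that] flip: blinfun_compose_assoc)
    ultimately show ?thesis
      using smooth_map_on_bilinear[OF bounded_bilinear_blinfun_compose smooth dK(1)]
      by (simp add: Dir_w K_def[symmetric] clinear_comp[OF clin dKc(1)] blinfun_compose_assoc
          del: blinfun_apply_blinfun_compose)
  next
    case Dir_wbar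
    have "P z o\<^sub>L d_wbar K z = d_wbar K z" if z: "z \<in> U" for z
    proof -
      have "d_wbar P z o\<^sub>L K z = (d_wbar P z o\<^sub>L P z) o\<^sub>L K z"
        by (simp add: PK[OF z] blinfun_compose_assoc)
      then have "d_wbar P z o\<^sub>L K z = 0" by (simp add: d_wbar_comp[OF z] comp_simps)
      then show ?thesis
        using wirtinger_comp(2)[OF smooth K open_domain z clin Kc]
          wirtinger_cong(2)[OF K open_domain PK[symmetric] z] by simp
    qed
    then have "P z o\<^sub>L (d_wbar K z o\<^sub>L P z) = d_wbar K z o\<^sub>L P z" if "z \<in> U" for z
      using that by (simp flip: blinfun_compose_assoc)
    then show ?thesis
      using smooth_map_on_bilinear[OF bounded_bilinear_blinfun_compose dK(2) smooth]
      by (simp add: Dir_wbar K_def[symmetric] clinear_comp[OF dKc(2) clin]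
          blinfun_compose_assoc idem del: blinfun_apply_blinfun_compose)
  qed
qed

lemma
  shows smooth_curvature_deriv: "smooth_map_on U (curvature_deriv \<sigma> P)"
    and clin_curvature_deriv: "z \<in> U \<Longrightarrow> clinear (blinfun_apply (curvature_deriv \<sigma> P z))"
    and comp_curvature_deriv: "z \<in> U \<Longrightarrow> P z o\<^sub>L curvature_deriv \<sigma> P z = curvature_deriv \<sigma> P z"
    and curvature_deriv_comp: "z \<in> U \<Longrightarrow> curvature_deriv \<sigma> P z o\<^sub>L P z = curvature_deriv \<sigma> P z"
  using curvature_deriv_props[of \<sigma>] by blast+

end

context hilbert_tensor
begin

text \<open>The product rule is applied to \<open>tensor_clinear_part\<close>, which is bilinear on
  all operators and agrees with \<open>tensor_op\<close> at the complex-linear values and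
  derivatives involved.\<close>

lemma
  assumes F: "smooth_map_on U F" and G: "smooth_map_on U G" and "open U"
    and Fc: "\<And>z. z \<in> U \<Longrightarrow> clinear (blinfun_apply (F z))"
    and Gc: "\<And>z. z \<in> U \<Longrightarrow> clinear (blinfun_apply (G z))"
  shows smooth_tensor: "smooth_map_on U (\<lambda>z. tensor_op t (F z) (G z))"
    and d_w_tensor: "w \<in> U \<Longrightarrow> d_w (\<lambda>z. tensor_op t (F z) (G z)) w
      = tensor_op t (d_w F w) (G w) + tensor_op t (F w) (d_w G w)"
    and d_wbar_tensor: "w \<in> U \<Longrightarrow> d_wbar (\<lambda>z. tensor_op t (F z) (G z)) w
      = tensor_op t (d_wbar F w) (G w) + tensor_op t (F w) (d_wbar G w)"
proof -
  have eq: "tensor_clinear_part (F z) (G z) = tensor_op t (F z) (G z)" if "z \<in> U" for z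
    by (rule tensor_clinear_part_eq[OF Fc[OF that] Gc[OF that]])
  have sm: "smooth_map_on U (\<lambda>z. tensor_clinear_part (F z) (G z))"
    by (rule smooth_map_on_bilinear[OF bounded_bilinear_tensor F G])
  from sm \<open>open U\<close> eq show "smooth_map_on U (\<lambda>z. tensor_op t (F z) (G z))"
    by (rule smooth_map_on_cong)
  have left: "tensor_clinear_part (scaleC_op \<i> A) B = scaleC_op \<i> (tensor_clinear_part A B)"
    and right: "tensor_clinear_part A (scaleC_op \<i> B) = scaleC_op \<i> (tensor_clinear_part A B)"
    if "clinear (blinfun_apply A)" "clinear (blinfun_apply B)" for A B
    using that by (auto intro!: blinfun_eqI_simple_tensors
        simp: tensor_clinear_part_apply clinear_part_id clinear_scaleC_op t_scaleC_left t_scaleC_right)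
  assume w: "w \<in> U"
  have c: "clinear (blinfun_apply (d_w F w))" "clinear (blinfun_apply (d_wbar F w))"
    "clinear (blinfun_apply (d_w G w))" "clinear (blinfun_apply (d_wbar G w))"
    using clinear_wirtinger[OF F \<open>open U\<close> w Fc] clinear_wirtinger[OF G \<open>open U\<close> w Gc] by blast+
  have cong: "d_w (\<lambda>z. tensor_op t (F z) (G z)) w = d_w (\<lambda>z. tensor_clinear_part (F z) (G z)) w"
    "d_wbar (\<lambda>z. tensor_op t (F z) (G z)) w = d_wbar (\<lambda>z. tensor_clinear_part (F z) (G z)) w"
    by (rule wirtinger_cong[OF sm \<open>open U\<close> _ w], simp add: eq)+
  have prod: "d_w (\<lambda>z. tensor_clinear_part (F z) (G z)) w
      = tensor_clinear_part (d_w F w) (G w) + tensor_clinear_part (F w) (d_w G w)"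
    "d_wbar (\<lambda>z. tensor_clinear_part (F z) (G z)) w
      = tensor_clinear_part (d_wbar F w) (G w) + tensor_clinear_part (F w) (d_wbar G w)"
    by (rule wirtinger_bilinear[OF bounded_bilinear_tensor F G \<open>open U\<close> w];
        simp add: Fc Gc left right)+
  show "d_w (\<lambda>z. tensor_op t (F z) (G z)) w
      = tensor_op t (d_w F w) (G w) + tensor_op t (F w) (d_w G w)"
    unfolding cong prod using c Fc[OF w] Gc[OF w] by (simp add: tensor_clinear_part_eq)
  show "d_wbar (\<lambda>z. tensor_op t (F z) (G z)) w
      = tensor_op t (d_wbar F w) (G w) + tensor_op t (F w) (d_wbar G w)"
    unfolding cong prod using c Fc[OF w] Gc[OF w] by (simp add: tensor_clinear_part_eq)
qed

text \<open>
  All mixed terms contain a factor \<open>P o\<^sub>L d_w P\<close> or \<open>d_wbar P o\<^sub>L P\<close>, which vanishes on a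
  holomorphic curve.
\<close>

lemma curvature_deriv_tensor:
  assumes "holomorphic_curve U P" and "holomorphic_curve U Q" and "w \<in> U"
  shows "curvature_deriv \<sigma> (\<lambda>z. tensor_op t (P z) (Q z)) w
    = tensor_op t (curvature_deriv \<sigma> P w) (Q w) + tensor_op t (P w) (curvature_deriv \<sigma> Q w)"
  using assms(3)
proof (induction \<sigma> arbitrary: w)
  interpret P: holomorphic_curve U P by fact
  interpret Q: holomorphic_curve U Q by fact
  note c = P.clin Q.clin P.clin_d_w P.clin_d_wbar Q.clin_d_w Q.clin_d_wbar
  note dPQ = d_w_tensor[OF P.smooth Q.smooth P.open_domain P.clin Q.clin]
    d_wbar_tensor[OF P.smooth Q.smooth P.open_domain P.clin Q.clin]
  {
    case Nil
    then show ?case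
      by (simp add: dPQ comp_simps tensor_op_comp c clinear_comp P.comp_d_w Q.comp_d_w
          P.d_wbar_comp Q.d_wbar_comp P.idem Q.idem tensor_op_zero_left tensor_op_zero_right clinear_zero
          P.comp_d_wbar Q.comp_d_wbar P.d_w_comp Q.d_w_comp
          del: blinfun_apply_blinfun_compose)
  next
    case (Cons d \<sigma>)
    define K where "K = curvature_deriv \<sigma> P"
    define L where "L = curvature_deriv \<sigma> Q"
    note w = \<open>w \<in> U\<close>
    have K: "smooth_map_on U K" "\<And>z. z \<in> U \<Longrightarrow> clinear (blinfun_apply (K z))"
      "\<And>z. z \<in> U \<Longrightarrow> K z o\<^sub>L P z = K z" "\<And>z. z \<in> U \<Longrightarrow> P z o\<^sub>L K z = K z"
      unfolding K_def using P.smooth_curvature_deriv P.clin_curvature_deriv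
        P.curvature_deriv_comp P.comp_curvature_deriv by blast+
    have L: "smooth_map_on U L" "\<And>z. z \<in> U \<Longrightarrow> clinear (blinfun_apply (L z))"
      "\<And>z. z \<in> U \<Longrightarrow> L z o\<^sub>L Q z = L z" "\<And>z. z \<in> U \<Longrightarrow> Q z o\<^sub>L L z = L z"
      unfolding L_def using Q.smooth_curvature_deriv Q.clin_curvature_deriv
        Q.curvature_deriv_comp Q.comp_curvature_deriv by blast+
    \<comment> \<open>This equation is differentiated at \<open>w\<close>, so it is needed
      throughout \<open>U\<close>; hence the point is arbitrary in the induction.\<close>
    have IH: "tensor_op t (K z) (Q z) + tensor_op t (P z) (L z)
        = curvature_deriv \<sigma> (\<lambda>z. tensor_op t (P z) (Q z)) z" if "z \<in> U" for z
      unfolding K_def L_def by (rule Cons.IH[OF that, symmetric])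
    have sKQ: "smooth_map_on U (\<lambda>z. tensor_op t (K z) (Q z))"
      by (rule smooth_tensor[OF K(1) Q.smooth P.open_domain K(2) Q.clin])
    have sPL: "smooth_map_on U (\<lambda>z. tensor_op t (P z) (L z))"
      by (rule smooth_tensor[OF P.smooth L(1) P.open_domain P.clin L(2)])
    note cong = wirtinger_cong[OF smooth_map_on_add[OF sKQ sPL] P.open_domain IH w]
      wirtinger_add[OF sKQ sPL w]
      d_w_tensor[OF K(1) Q.smooth P.open_domain K(2) Q.clin w]
      d_wbar_tensor[OF K(1) Q.smooth P.open_domain K(2) Q.clin w]
      d_w_tensor[OF P.smooth L(1) P.open_domain P.clin L(2) w]
      d_wbar_tensor[OF P.smooth L(1) P.open_domain P.clin L(2) w]
    note cw = c[OF w] K(2)[OF w] L(2)[OF w]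
      clinear_wirtinger[OF K(1) P.open_domain w K(2)] clinear_wirtinger[OF L(1) P.open_domain w L(2)]
    show ?case
    proof (cases d)
      case Dir_w
      then show ?thesis
        by (simp add: cong comp_simps tensor_op_comp cw clinear_comp P.comp_d_w[OF w]
            Q.comp_d_w[OF w] P.idem[OF w] Q.idem[OF w] tensor_op_zero_left tensor_op_zero_right clinear_zero
            K(4)[OF w] L(4)[OF w] flip: K_def L_def del: blinfun_apply_blinfun_compose)
    next
      case Dir_wbar
      then show ?thesis
        by (simp add: cong comp_simps tensor_op_comp cw clinear_comp P.d_wbar_comp[OF w]
            Q.d_wbar_comp[OF w] P.idem[OF w] Q.idem[OF w] tensor_op_zero_left tensor_op_zero_right clinear_zero
            K(3)[OF w] L(3)[OF w] flip: K_def L_def del: blinfun_apply_blinfun_compose)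
    qed
  }
qed

end

theorem theorem4p7:
  fixes \<Omega> :: "complex set"
    and E\<^sub>1 :: "complex \<Rightarrow> 'a::chilbert_space set"
    and E\<^sub>2 :: "complex \<Rightarrow> 'b::chilbert_space set"
    and \<iota>\<^sub>1 :: "'h1::chilbert_space \<Rightarrow> 'a"
    and \<iota>\<^sub>2 :: "'h2::chilbert_space \<Rightarrow> 'b"
    and P\<^sub>1 :: "complex \<Rightarrow> 'h1 \<Rightarrow>\<^sub>L 'h1"
    and P\<^sub>2 :: "complex \<Rightarrow> 'h2 \<Rightarrow>\<^sub>L 'h2"
    and t :: "'h1 \<Rightarrow> 'h2 \<Rightarrow> 'k::chilbert_space"
    and i j :: nat
    and \<sigma> :: "direction list"
    and w :: complex
  assumes "open \<Omega>" and "connected \<Omega>"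
    and "hermitian_holomorphic_bundle \<Omega> E\<^sub>1"
    and "hermitian_holomorphic_bundle \<Omega> E\<^sub>2"
    and "closed_span_of_fibres \<Omega> E\<^sub>1 \<iota>\<^sub>1"
    and "closed_span_of_fibres \<Omega> E\<^sub>2 \<iota>\<^sub>2"
    and "\<And>z. z \<in> \<Omega> \<Longrightarrow> orthogonal_projection_onto (P\<^sub>1 z) (\<iota>\<^sub>1 -` E\<^sub>1 z)"
    and "\<And>z. z \<in> \<Omega> \<Longrightarrow> orthogonal_projection_onto (P\<^sub>2 z) (\<iota>\<^sub>2 -` E\<^sub>2 z)"
    and "hilbert_tensor_product t"
    and "\<sigma> \<in> orders i j"
    and "w \<in> \<Omega>"
  shows "curvature_deriv \<sigma> (\<lambda>z. tensor_op t (P\<^sub>1 z) (P\<^sub>2 z)) w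
    = tensor_op t (curvature_deriv \<sigma> P\<^sub>1 w) (P\<^sub>2 w) + tensor_op t (P\<^sub>1 w) (curvature_deriv \<sigma> P\<^sub>2 w)"
proof -
  obtain U\<^sub>1 where 1: "w \<in> U\<^sub>1" "holomorphic_curve U\<^sub>1 P\<^sub>1"
    using bundle_projection_holomorphic_curve[OF assms(3,5,7,11)] by blast
  obtain U\<^sub>2 where 2: "w \<in> U\<^sub>2" "holomorphic_curve U\<^sub>2 P\<^sub>2"
    using bundle_projection_holomorphic_curve[OF assms(4,6,8,11)] by blast
  \<comment> \<open>The frames of the two bundles come with different neighbourhoods of
    \<open>w\<close>; the claim at \<open>w\<close> only needs a common smaller one.\<close>
  have op: "open (U\<^sub>1 \<inter> U\<^sub>2)"
    using 1(2) 2(2) by (simp add: holomorphic_curve.open_domain open_Int)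
  have "hilbert_tensor t" using assms(9) by (rule hilbert_tensor.intro)
  then show ?thesis
    by (rule hilbert_tensor.curvature_deriv_tensor[where U = "U\<^sub>1 \<inter> U\<^sub>2"])
      (use 1(1) 2(1) holomorphic_curve_subset[OF 1(2) op] holomorphic_curve_subset[OF 2(2) op]
        in simp_all)
qed

end
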